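(* Let $d\geq 1$ and let $X$ be a simplicial complex with $n$ vertices satisfying $h(X)\leq d$. Then \[ \operatorname{box}_d(X)\leq \left\lfloor\frac{1}{d+1}\binom{n}{d}\right\rfloor. \] Moreover, if $h(X)=d$, then $\operatorname{box}_d(X)=\frac{1}{d+1}\binom{n}{d}$ if and only if the missing faces of $X$ form a Steiner $(d,d+1,n)$-system.
   Context: For a family $\mathcal{F}=\{F_1,\ldots,F_n\}$ of sets, its nerve is $N(\mathcal{F})=\{\sigma\subset[n]: \bigcap_{i\in\sigma}F_i\neq\emptyset\}$. A simplicial complex $X$ is $d$-representable if it is isomorphic to the nerve of a finite family of compact convex sets in $\mathbb{R}^d$. The $d$-boxicity $\operatorname{box}_d(X)$ is the minimal $k$ such that $X$ (on vertex set $V$) can be written as the intersection of $k$ $d$-representable simplicial complexes on vertex set $V$. A missing face of $X$ (on vertex set $V$) is a set $\tau\subset V$ with $\tau\notin X$ but $\sigma\in X$ for every $\sigma\subsetneq\tau$; $h(X)$ denotes the maximal dimension (size minus one) of a missing face of $X$. A family of $k$-subsets of an $n$-set $V$ is a Steiner $(t,k,n)$-system if every $t$-subset of $V$ is contained in exactly one member of the family.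
   Formalization: The upper bound is stated only for n > d or X a full simplex; when n ≤ d and X is not a full simplex the right-hand side is 0 while box_d(X) ≥ 1 (e.g. two isolated vertices, d = 2), so the printed bound is false there. *)

theory Defs
  imports "HOL-Analysis.Analysis"
begin

(* Abstract simplicial complex X with vertex set V: every v in V is a vertex of X, so X has
   exactly card V vertices. *)
definition abstract_complex :: "'v set \<Rightarrow> 'v set set \<Rightarrow> bool" where
  "abstract_complex V X \<longleftrightarrow>
     finite V \<and> X \<subseteq> Pow V \<and> {} \<in> X \<and> (\<forall>v\<in>V. {v} \<in> X) \<and>
     (\<forall>\<sigma>\<in>X. \<forall>\<tau>\<subseteq>\<sigma>. \<tau> \<in> X)"

(* The intersection over the empty set of indices is UNIV, so {} always belongs to the nerve. *)
definition nerve :: "nat \<Rightarrow> (nat \<Rightarrow> 'a set) \<Rightarrow> nat set set" where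
  "nerve m F = {\<sigma>. \<sigma> \<subseteq> {1..m} \<and> (\<Inter>i\<in>\<sigma>. F i) \<noteq> {}}"

definition complex_iso :: "'v set \<Rightarrow> 'v set set \<Rightarrow> 'w set \<Rightarrow> 'w set set \<Rightarrow> bool" where
  "complex_iso V X W Y \<longleftrightarrow> (\<exists>f. bij_betw f V W \<and> Y = (\<lambda>\<sigma>. f ` \<sigma>) ` X)"

(* The index type 'd determines the dimension: real ^ 'd is Euclidean space of dimension CARD('d). *)
definition representable :: "'d::finite itself \<Rightarrow> 'v set \<Rightarrow> 'v set set \<Rightarrow> bool" where
  "representable _ V X \<longleftrightarrow>
     (\<exists>m. \<exists>F :: nat \<Rightarrow> (real ^ 'd) set.
        (\<forall>i\<in>{1..m}. compact (F i) \<and> convex (F i)) \<and> complex_iso V X {1..m} (nerve m F))"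

(* The intersection of no complexes on V is the full simplex Pow V, so boxicity 0 means X = Pow V.
   The value is infinity if X is not an intersection of finitely many representable complexes. *)
definition boxicity :: "'d::finite itself \<Rightarrow> 'v set \<Rightarrow> 'v set set \<Rightarrow> enat" where
  "boxicity D V X =
     Inf {enat k | k. \<exists>Y. (\<forall>i<k. abstract_complex V (Y i) \<and> representable D V (Y i)) \<and>
                          X = Pow V \<inter> (\<Inter>i<k. Y i)}"

definition missing_faces :: "'v set \<Rightarrow> 'v set set \<Rightarrow> 'v set set" where
  "missing_faces V X = {\<tau>. \<tau> \<subseteq> V \<and> \<tau> \<notin> X \<and> (\<forall>\<sigma>. \<sigma> \<subset> \<tau> \<longrightarrow> \<sigma> \<in> X)}"

(* Missing faces of a simplicial complex have dimension at least 1; the inserted -1 is attained only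
   when there are none, that is, when X = Pow V. *)
definition max_missing_dim :: "'v set \<Rightarrow> 'v set set \<Rightarrow> int" where
  "max_missing_dim V X = Max (insert (-1) ((\<lambda>\<tau>. int (card \<tau>) - 1) ` missing_faces V X))"

definition steiner_system :: "nat \<Rightarrow> nat \<Rightarrow> 'v set \<Rightarrow> 'v set set \<Rightarrow> bool" where
  "steiner_system t k V S \<longleftrightarrow>
     (\<forall>B\<in>S. B \<subseteq> V \<and> card B = k) \<and>
     (\<forall>T. T \<subseteq> V \<and> card T = t \<longrightarrow> (\<exists>!B. B \<in> S \<and> T \<subseteq> B))"

(* The bound on the boxicity fails whenever X has at most d vertices and is not the full simplex
   (for instance two isolated points, d = 2). *)
lemma bound_fails_for_few_vertices:
  fixes V :: "'v set" and D :: "'d::finite itself"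
  assumes "card V \<le> CARD('d)" "X \<noteq> Pow V"
  shows "\<not> ereal_of_enat (boxicity D V X) \<le>
      ereal (real_of_int \<lfloor>1 / (real CARD('d) + 1) * real (card V choose CARD('d))\<rfloor>)"
proof -
  have "card V choose CARD('d) \<le> 1"
    using assms(1) by (cases "card V = CARD('d)") (auto simp: binomial_eq_0)
  then have "real (card V choose CARD('d)) < real CARD('d) + 1"
    by (smt (verit) of_nat_1 of_nat_le_iff of_nat_0_less_iff zero_less_card_finite)
  then have "\<lfloor>1 / (real CARD('d) + 1) * real (card V choose CARD('d))\<rfloor> = 0"
    by (auto simp: floor_eq_iff)
  moreover have "boxicity D V X \<noteq> 0"
  proof
    let ?A = "{enat k | k. \<exists>Y. (\<forall>i<k. abstract_complex V (Y i) \<and> representable D V (Y i)) \<and>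
                          X = Pow V \<inter> (\<Inter>i<k. Y i)}"
    assume "boxicity D V X = 0"
    then have I: "Inf ?A = 0" by (simp add: boxicity_def)
    then have "?A \<noteq> {}" by (metis Inf_enat_def i0_ne_infinity)
    then have "Inf ?A \<in> ?A" unfolding Inf_enat_def by (metis (mono_tags, lifting) LeastI ex_in_conv)
    then have "0 \<in> ?A" using I by simp
    then show False using assms(2) by (auto simp: zero_enat_def)
  qed
  ultimately show ?thesis
    by (cases "boxicity D V X") (auto simp: zero_enat_def)
qed

end

(*
The upper bound: for a non-face tau with d + 1 elements take a d-simplex with facets indexed by tau
and let the set of a vertex v be the convex hull of the barycenters of the faces opposite those sets
sigma in tau for which sigma + v is a face of X (with v in sigma if v is in tau). The nerve contains
X and excludes every non-face with at most one element outside tau. Hence boxicity is at most the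
size of a maximal family of (d + 1)-element non-faces meeting pairwise in less than d elements, and
the d-element subsets of the members of such a family are distinct.

If the missing faces form a Steiner system, a representable complex containing X excludes at most one
of them. Otherwise let B, C be two excluded blocks with smallest union. By minimality and Helly's
theorem the sets of B + C - {a, b} have a common point for all a in C - B and b in B. Minimizing a
weighted sum of squared distances to the sets of B gives a point which lies in the simplex of these
points for each a, hence in all sets of C - B. As the weight of some b in B - C tends to 0, it
approaches a common point of all sets of C.

Conversely, if the bound is attained then a maximal family P as above is a Steiner system. If there
were another (d + 1)-element non-face rho, two members of P adjacent to rho could be replaced by rho
(for d = 1, possibly by a complex that is a disjoint union of simplices on their vertices), and
fewer complexes would suffice.
*)
theory Submission
  imports Defs
begin

subsection \<open>Convex sets with a missing intersection\<close>

lemma sum_neg: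
  fixes f :: "'b \<Rightarrow> real"
  assumes "finite A" "A \<noteq> {}" "\<And>x. x \<in> A \<Longrightarrow> f x < 0"
  shows "sum f A < 0"
  using sum_strict_mono[of A f "\<lambda>_. 0"] assms by simp

text \<open>\<open>DIM('a) + 1\<close> vectors are linearly dependent. The sign pattern forces a
  dependency with one positive coefficient to have only positive ones, so normalizing it writes 0 as
  a convex combination.\<close>

lemma zero_in_convex_hull_sign_pattern:
  fixes u q :: "'v \<Rightarrow> 'a::euclidean_space"
  assumes card: "card B = DIM('a) + 1" and u0: "(\<Sum>b\<in>B. u b) = 0"
    and neg: "\<And>b c. b \<in> B \<Longrightarrow> c \<in> B \<Longrightarrow> b \<noteq> c \<Longrightarrow> u c \<bullet> q b < 0"
  shows "0 \<in> convex hull (q ` B)"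
proof -
  have fin: "finite B" using card by (metis Suc_eq_plus1 card.infinite nat.distinct(1))
  have compl: "(\<Sum>c\<in>B - M. u c) = - (\<Sum>c\<in>M. u c)" if "M \<subseteq> B" for M
    using u0 sum.subset_diff[OF that fin, of u] by (simp add: eq_neg_iff_add_eq_0)
  have pos: "u b \<bullet> q b > 0" if b: "b \<in> B" for b
  proof -
    have "B - {b} \<noteq> {}"
    proof
      assume "B - {b} = {}"
      then have "B = {b}" using b by auto
      then show False using card DIM_positive[where 'a='a] by simp
    qed
    then have "(\<Sum>c\<in>B - {b}. u c \<bullet> q b) < 0"
      using fin neg b by (intro sum_neg) auto
    moreover have "(\<Sum>c\<in>B - {b}. u c \<bullet> q b) = - (u b \<bullet> q b)"
      using compl[of "{b}"] b by (simp flip: inner_sum_left)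
    ultimately show ?thesis by simp
  qed
  \<comment> \<open>By \<open>pos\<close> and \<open>neg\<close> the functional \<open>u b\<close>
    separates \<open>q b\<close> from all other \<open>q c\<close>. Injectivity lets a dependency of
    the image set be indexed by \<open>B\<close>.\<close>
  have inj: "inj_on q B"
    by (rule inj_onI) (metis neg pos less_asym)
  have "dependent (q ` B)"
    using card fin inj by (intro dependent_biggerset) (simp add: card_image)
  then obtain m where m: "\<exists>v\<in>q ` B. m v \<noteq> 0" "(\<Sum>v\<in>q ` B. m v *\<^sub>R v) = 0"
    using dependent_finite[of "q ` B"] fin by auto
  have "\<exists>\<mu>. (\<Sum>b\<in>B. \<mu> b *\<^sub>R q b) = 0 \<and> (\<exists>b\<in>B. \<mu> b > 0)"
  proof -
    have s: "(\<Sum>b\<in>B. m (q b) *\<^sub>R q b) = 0"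
      using m(2) inj by (simp add: sum.reindex)
    then have s': "(\<Sum>b\<in>B. (- m (q b)) *\<^sub>R q b) = 0" by (simp add: sum_negf)
    obtain b where "b \<in> B" "m (q b) \<noteq> 0" using m(1) by auto
    then have "m (q b) > 0 \<or> - m (q b) > 0" by auto
    then show ?thesis
    proof
      assume "m (q b) > 0" with s \<open>b \<in> B\<close> show ?thesis by (intro exI[of _ "\<lambda>b. m (q b)"]) auto
    next
      assume "- m (q b) > 0" with s' \<open>b \<in> B\<close> show ?thesis
        by (intro exI[of _ "\<lambda>b. - m (q b)"]) auto
    qed
  qed
  then obtain \<mu> b1 where \<mu>: "(\<Sum>b\<in>B. \<mu> b *\<^sub>R q b) = 0" "b1 \<in> B" "\<mu> b1 > 0" by auto
  \<comment> \<open>Pair the dependency with the sum \<open>U\<close> of the \<open>u c\<close> over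
    \<open>M\<close>. If \<open>M\<close> is nonempty, \<open>U \<bullet> q b\<close> is negative
    outside \<open>M\<close> and, since the \<open>u c\<close> sum to 0 over \<open>B\<close>,
    nonnegative on \<open>M\<close>; the pairing would be negative instead of 0.\<close>
  define M where "M = {b\<in>B. \<mu> b \<le> 0}"
  define U where "U = (\<Sum>c\<in>M. u c)"
  have M: "M \<subseteq> B" "finite M" using fin by (auto simp: M_def)
  have "M = {}"
  proof (rule ccontr)
    assume ne: "M \<noteq> {}"
    have "(\<Sum>b\<in>B - M. \<mu> b *\<^sub>R q b) + (\<Sum>b\<in>M. \<mu> b *\<^sub>R q b) = 0"
      using \<mu>(1) sum.subset_diff[OF M(1) fin, of "\<lambda>b. \<mu> b *\<^sub>R q b"] by simp
    then have "U \<bullet> (\<Sum>b\<in>B - M. \<mu> b *\<^sub>R q b) + U \<bullet> (\<Sum>b\<in>M. \<mu> b *\<^sub>R q b) = 0"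
      by (metis inner_add_right inner_zero_right)
    moreover have "U \<bullet> (\<Sum>b\<in>B - M. \<mu> b *\<^sub>R q b) < 0"
      unfolding inner_sum_right
    proof (rule sum_neg)
      fix b assume b: "b \<in> B - M"
      have "U \<bullet> q b = (\<Sum>c\<in>M. u c \<bullet> q b)" by (simp add: U_def inner_sum_left)
      also have "\<dots> < 0" using b M ne by (intro sum_neg neg) auto
      finally have "U \<bullet> q b < 0" .
      moreover have "\<mu> b > 0" using b by (auto simp: M_def)
      ultimately show "U \<bullet> (\<mu> b *\<^sub>R q b) < 0" by (simp add: mult_pos_neg)
    qed (use fin \<mu> in \<open>auto simp: M_def\<close>)
    moreover have "U \<bullet> (\<Sum>b\<in>M. \<mu> b *\<^sub>R q b) \<le> 0"
      unfolding inner_sum_right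
    proof (rule sum_nonpos)
      fix b assume b: "b \<in> M"
      have "- (U \<bullet> q b) = (\<Sum>c\<in>B - M. u c \<bullet> q b)"
        by (simp add: U_def compl[OF M(1)] flip: inner_sum_left)
      also have "\<dots> \<le> 0" using b M by (intro sum_nonpos less_imp_le neg) auto
      finally have "U \<bullet> q b \<ge> 0" by simp
      then show "U \<bullet> (\<mu> b *\<^sub>R q b) \<le> 0" using b by (simp add: M_def mult_nonpos_nonneg)
    qed
    ultimately show False by simp
  qed
  then have \<mu>pos: "\<mu> b > 0" if "b \<in> B" for b using that by (force simp: M_def)
  define s where "s = sum \<mu> B"
  have s: "s > 0" unfolding s_def using \<mu>pos \<mu>(2) fin by (intro sum_pos) auto
  have "(\<Sum>b\<in>B. (\<mu> b / s) *\<^sub>R q b) \<in> convex hull (q ` B)"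
    using fin s \<mu>pos
    by (intro convex_sum) (auto simp: hull_inc s_def less_imp_le simp flip: sum_divide_distrib)
  moreover have "(\<Sum>b\<in>B. (\<mu> b / s) *\<^sub>R q b) = inverse s *\<^sub>R (\<Sum>b\<in>B. \<mu> b *\<^sub>R q b)"
    by (simp add: scaleR_sum_right divide_inverse mult.commute)
  ultimately show ?thesis using \<mu>(1) by simp
qed

text \<open>A minimizer \<open>y\<close> of the weighted sum of squared distances over the compact
  hull \<open>K\<close> of all the sets is the weighted mean of its own projections: otherwise
  moving to that mean would lower the sum.\<close>

lemma weighted_projection_balance:
  fixes F :: "'v \<Rightarrow> 'a::euclidean_space set" and w :: "'v \<Rightarrow> real"
  assumes B: "finite B" "B \<noteq> {}" and w: "\<And>b. b \<in> B \<Longrightarrow> w b > 0"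
    and F: "\<And>b. b \<in> B \<Longrightarrow> compact (F b)" "\<And>b. b \<in> B \<Longrightarrow> convex (F b)"
      "\<And>b. b \<in> B \<Longrightarrow> F b \<noteq> {}"
  shows "\<exists>y. (\<Sum>b\<in>B. w b *\<^sub>R (y - closest_point (F b) y)) = 0 \<and>
    (\<forall>b\<in>B. \<forall>z\<in>F b. (\<Sum>b\<in>B. w b * (dist y (closest_point (F b) y))\<^sup>2)
        \<le> (\<Sum>b\<in>B. w b * (dist z (closest_point (F b) z))\<^sup>2))"
proof -
  define K where "K = convex hull (\<Union>b\<in>B. F b)"
  define \<phi> where "\<phi> = (\<lambda>y. \<Sum>b\<in>B. w b * (dist y (closest_point (F b) y))\<^sup>2)"
  have FK: "F b \<subseteq> K" if "b \<in> B" for b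
    using that hull_subset[of "\<Union>b\<in>B. F b" convex] by (auto simp: K_def)
  have cK: "compact K" "convex K" "K \<noteq> {}"
    using B F FK by (auto simp: K_def intro!: compact_convex_hull compact_UN)
  have "continuous_on K \<phi>"
    unfolding \<phi>_def using F compact_imp_closed
    by (intro continuous_intros continuous_on_closest_point) auto
  then obtain y where y: "y \<in> K" "\<And>z. z \<in> K \<Longrightarrow> \<phi> y \<le> \<phi> z"
    using continuous_attains_inf[OF cK(1,3)] by blast
  define x where "x = (\<lambda>b. closest_point (F b) y)"
  have x: "x b \<in> F b" if "b \<in> B" for b
    unfolding x_def using that F compact_imp_closed by (intro closest_point_in_set) auto
  define W where "W = sum w B"
  have W: "W > 0" unfolding W_def using B w by (intro sum_pos) auto
  define z where "z = (\<Sum>b\<in>B. (w b / W) *\<^sub>R x b)"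
  have zW: "W *\<^sub>R z = (\<Sum>b\<in>B. w b *\<^sub>R x b)"
    using W by (simp add: z_def scaleR_sum_right)
  have "z \<in> K"
    unfolding z_def using B cK(2) w W x FK
    by (intro convex_sum) (auto simp: W_def less_imp_le simp flip: sum_divide_distrib)
  have "\<phi> z \<le> (\<Sum>b\<in>B. w b * (dist z (x b))\<^sup>2)"
    unfolding \<phi>_def
  proof (rule sum_mono)
    fix b assume b: "b \<in> B"
    have "dist z (closest_point (F b) z) \<le> dist z (x b)"
      using x[OF b] F[OF b] compact_imp_closed by (intro closest_point_le) auto
    then show "w b * (dist z (closest_point (F b) z))\<^sup>2 \<le> w b * (dist z (x b))\<^sup>2"
      using w[OF b] by (simp add: power_mono)
  qed
  \<comment> \<open>Parallel axis identity: the weighted second moment of the points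
    \<open>x b\<close> about their mean \<open>z\<close> is smaller than about \<open>y\<close> by
    \<open>W * (dist y z)\<^sup>2\<close>.\<close>
  also have "\<dots> = (\<Sum>b\<in>B. w b * (dist y (x b))\<^sup>2) - W * (dist y z)\<^sup>2"
  proof -
    have "(\<Sum>b\<in>B. w b * (dist y (x b))\<^sup>2) - (\<Sum>b\<in>B. w b * (dist z (x b))\<^sup>2)
        = (\<Sum>b\<in>B. w b * (y \<bullet> y - z \<bullet> z) - 2 * ((y - z) \<bullet> (w b *\<^sub>R x b)))"
      by (simp flip: sum_subtractf)
        (intro sum.cong refl, simp add: dist_norm power2_norm_eq_inner algebra_simps inner_commute)
    also have "\<dots> = W * (y \<bullet> y - z \<bullet> z) - 2 * ((y - z) \<bullet> (W *\<^sub>R z))"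
      unfolding zW
      by (simp add: sum_subtractf inner_sum_right sum_distrib_left)
        (simp add: W_def flip: sum_distrib_right)
    also have "\<dots> = W * (dist y z)\<^sup>2"
      by (simp add: dist_norm power2_norm_eq_inner algebra_simps inner_commute)
    finally show ?thesis by simp
  qed
  also have "\<dots> = \<phi> y - W * (dist y z)\<^sup>2" by (simp add: \<phi>_def x_def)
  finally have "W * (dist y z)\<^sup>2 \<le> 0" using y(2)[OF \<open>z \<in> K\<close>] by simp
  then have "y = z" using W by (simp add: mult_le_0_iff)
  have "(\<Sum>b\<in>B. w b *\<^sub>R (y - x b)) = W *\<^sub>R y - (\<Sum>b\<in>B. w b *\<^sub>R x b)"
    by (simp add: scaleR_right_diff_distrib sum_subtractf W_def scaleR_left.sum)
  also have "\<dots> = 0" using zW \<open>y = z\<close> by simp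
  finally have "(\<Sum>b\<in>B. w b *\<^sub>R (y - x b)) = 0" .
  moreover have "\<forall>b\<in>B. \<forall>z\<in>F b. \<phi> y \<le> \<phi> z" using y(2) FK by blast
  ultimately show ?thesis unfolding x_def \<phi>_def by (intro exI[of _ y] conjI)
qed

text \<open>Let \<open>x c\<close> be the projection of \<open>y\<close> to \<open>F c\<close>. Then
  \<open>u c = w c *\<^sub>R (y - x c)\<close> is the normal of a hyperplane through
  \<open>x c\<close> that separates \<open>y\<close> from \<open>F c\<close>. Since
  \<open>p b\<close> lies in \<open>F c\<close>, \<open>u c \<bullet> (p b - y)\<close> is negative
  for \<open>b \<noteq> c\<close>, and the sign pattern puts 0 in the hull of the points
  \<open>p b - y\<close>.\<close>

lemma balanced_point_in_simplex:
  fixes F :: "'v \<Rightarrow> 'a::euclidean_space set"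
  assumes card: "card B = DIM('a) + 1" and w: "\<And>b. b \<in> B \<Longrightarrow> w b > 0"
    and F: "\<And>b. b \<in> B \<Longrightarrow> compact (F b)" "\<And>b. b \<in> B \<Longrightarrow> convex (F b)"
      "\<And>b. b \<in> B \<Longrightarrow> F b \<noteq> {}"
    and empty: "(\<Inter>b\<in>B. F b) = {}"
    and bal: "(\<Sum>b\<in>B. w b *\<^sub>R (y - closest_point (F b) y)) = 0"
    and p: "\<And>b c. b \<in> B \<Longrightarrow> c \<in> B \<Longrightarrow> b \<noteq> c \<Longrightarrow> p b \<in> F c"
  shows "y \<in> convex hull (p ` B)"
proof -
  have fin: "finite B" using card by (metis Suc_eq_plus1 card.infinite nat.distinct(1))
  define x where "x = (\<lambda>b. closest_point (F b) y)"
  define u where "u = (\<lambda>b. w b *\<^sub>R (y - x b))"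
  have x: "x b \<in> F b" if "b \<in> B" for b
    unfolding x_def using that F compact_imp_closed by (intro closest_point_in_set) auto
  have u0: "(\<Sum>b\<in>B. u b) = 0" using bal by (simp add: u_def x_def)
  have uF: "u c \<bullet> (z - x c) \<le> 0" if "c \<in> B" "z \<in> F c" for c z
    using closest_point_dot[of "F c" z y] F[OF that(1)] that w[OF that(1)] compact_imp_closed
    by (auto simp: u_def x_def mult_le_0_iff)
  have uy: "u c \<bullet> (y - x c) = w c * (norm (y - x c))\<^sup>2" for c
    by (simp add: u_def power2_norm_eq_inner)
  \<comment> \<open>If \<open>y\<close> were in \<open>F c\<close>, the remaining \<open>u b\<close>
    would still sum to 0. Testing them against \<open>p c\<close>, which lies in all the other sets,
    makes the weighted sum of squared distances nonpositive, so \<open>y\<close> would lie in every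
    set, against \<open>empty\<close>.\<close>
  have ne: "x c \<noteq> y" if c: "c \<in> B" for c
  proof
    assume "x c = y"
    then have uc: "u c = 0" by (simp add: u_def)
    have u0': "(\<Sum>b\<in>B - {c}. u b) = 0" using u0 uc fin c by (simp add: sum_diff1)
    have "(\<Sum>b\<in>B - {c}. w b * (norm (y - x b))\<^sup>2)
        = (\<Sum>b\<in>B - {c}. u b \<bullet> (p c - x b) + u b \<bullet> (y - p c))"
      by (intro sum.cong refl) (simp add: uy[symmetric] inner_diff_right)
    also have "\<dots> = (\<Sum>b\<in>B - {c}. u b \<bullet> (p c - x b)) + (\<Sum>b\<in>B - {c}. u b) \<bullet> (y - p c)"
      by (simp add: sum.distrib inner_sum_left)
    also have "\<dots> \<le> 0" using u0' uF p c by (auto intro!: sum_nonpos)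
    finally have le: "(\<Sum>b\<in>B - {c}. w b * (norm (y - x b))\<^sup>2) \<le> 0" .
    have nn: "0 \<le> w b * (norm (y - x b))\<^sup>2" if "b \<in> B - {c}" for b
      using that w[of b] by simp
    have "(\<Sum>b\<in>B - {c}. w b * (norm (y - x b))\<^sup>2) = 0"
      using le sum_nonneg[OF nn] by (rule antisym)
    then have "\<forall>b\<in>B - {c}. w b * (norm (y - x b))\<^sup>2 = 0"
      using fin nn by (subst (asm) sum_nonneg_eq_0_iff) auto
    then have "\<forall>b\<in>B. y = x b" using w \<open>x c = y\<close> by force
    then have "y \<in> (\<Inter>b\<in>B. F b)" using x by auto
    then show False using empty by simp
  qed
  have "0 \<in> convex hull ((\<lambda>b. p b - y) ` B)"
  proof (rule zero_in_convex_hull_sign_pattern[OF card u0])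
    fix b c assume bc: "b \<in> B" "c \<in> B" "b \<noteq> c"
    have "u c \<bullet> (p b - y) = u c \<bullet> (p b - x c) - u c \<bullet> (y - x c)"
      by (simp add: inner_diff_right)
    also have "\<dots> < 0"
    proof -
      have "u c \<bullet> (y - x c) > 0" using w[OF bc(2)] ne[OF bc(2)] by (simp add: uy)
      then show ?thesis using uF[OF bc(2) p[OF bc]] by simp
    qed
    finally show "u c \<bullet> (p b - y) < 0" .
  qed
  moreover have "(\<lambda>b. p b - y) ` B = (\<lambda>z. - y + z) ` (p ` B)" by (auto simp: image_image)
  ultimately show ?thesis by (auto simp only: convex_hull_translation) auto
qed

text \<open>Whatever the weights, a balance point of the sets of \<open>B\<close> lies in
  \<open>F v\<close> for each \<open>v \<in> A\<close>: as \<open>A\<close> has two elements, some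
  \<open>a \<in> A\<close> differs from \<open>v\<close>, and the hull of the points
  \<open>p a b\<close> contains the balance point and lies in \<open>F v\<close>. A small weight at
  \<open>b0\<close> brings the point close to all other sets of \<open>B\<close>, and compactness
  gives a common point.\<close>

lemma intersection_omitting_one:
  fixes F :: "'v \<Rightarrow> 'a::euclidean_space set"
  assumes A: "A \<inter> B = {}" "card A \<ge> 2" and card: "card B = DIM('a) + 1"
    and F: "\<And>v. v \<in> A \<union> B \<Longrightarrow> compact (F v)" "\<And>v. v \<in> A \<union> B \<Longrightarrow> convex (F v)"
    and empty: "(\<Inter>b\<in>B. F b) = {}"
    and ne: "\<And>a b. a \<in> A \<Longrightarrow> b \<in> B \<Longrightarrow> (\<Inter>v\<in>A \<union> B - {a, b}. F v) \<noteq> {}"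
    and b0: "b0 \<in> B"
  shows "(\<Inter>v\<in>A \<union> B - {b0}. F v) \<noteq> {}"
proof
  assume contra: "(\<Inter>v\<in>A \<union> B - {b0}. F v) = {}"
  have fin: "finite A" "finite B" using A(2) card
    by (metis card.infinite not_numeral_le_zero, metis Suc_eq_plus1 card.infinite nat.distinct(1))
  obtain a1 where a1: "a1 \<in> A" using A(2) by fastforce
  have "\<forall>a\<in>A. \<forall>b\<in>B. \<exists>x. x \<in> (\<Inter>v\<in>A \<union> B - {a, b}. F v)" using ne by blast
  then obtain p where p: "\<And>a b v. a \<in> A \<Longrightarrow> b \<in> B \<Longrightarrow> v \<in> A \<union> B - {a, b} \<Longrightarrow> p a b \<in> F v"
    by (metis INT_E)
  have Bne: "B \<noteq> {}" using b0 by auto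
  have FB: "F b \<noteq> {}" "compact (F b)" "convex (F b)" if b: "b \<in> B" for b
  proof -
    show "compact (F b)" "convex (F b)" using F b by auto
    have "B \<noteq> {b}" using card DIM_positive[where 'a='a] by auto
    then obtain c where "c \<in> B" "c \<noteq> b" using b by auto
    then show "F b \<noteq> {}" using p[OF a1, of c b] b A(1) a1 by auto
  qed
  define G where "G = (\<Inter>a\<in>A. F a)"
  have G: "compact G" unfolding G_def using a1 F by (intro compact_Inter) auto
  have yG: "y \<in> G" if w: "\<And>b. b \<in> B \<Longrightarrow> w b > 0"
    and bal: "(\<Sum>b\<in>B. w b *\<^sub>R (y - closest_point (F b) y)) = 0" for w y
  proof -
    have hull: "y \<in> convex hull (p a ` B)" if a: "a \<in> A" for a
    proof (rule balanced_point_in_simplex[OF card _ _ _ _ empty bal])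
      show "p a b \<in> F c" if "b \<in> B" "c \<in> B" "b \<noteq> c" for b c
        using p[OF a that(1), of c] that A(1) a by auto
    qed (use w FB in auto)
    have "y \<in> F v" if v: "v \<in> A" for v
    proof -
      have "A \<noteq> {v}" using A(2) by auto
      then obtain a where a: "a \<in> A" "a \<noteq> v" using v by auto
      have "p a ` B \<subseteq> F v" using p[OF a(1), of _ v] v a A(1) by auto
      then have "convex hull (p a ` B) \<subseteq> F v" using F v by (intro hull_minimal) auto
      then show ?thesis using hull[OF a(1)] by auto
    qed
    then show ?thesis by (simp add: G_def)
  qed
  \<comment> \<open>If \<open>A \<union> B - {b0}\<close> has no common point, this sum is positive
    on the compact set \<open>G\<close> and so has a positive minimum there.\<close>
  define \<psi> where "\<psi> = (\<lambda>y. \<Sum>b\<in>B - {b0}. (dist y (closest_point (F b) y))\<^sup>2)"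
  have \<psi>pos: "\<psi> y > 0" if "y \<in> G" for y
  proof -
    have "y \<notin> (\<Inter>v\<in>A \<union> B - {b0}. F v)" using contra by simp
    then obtain b where b: "b \<in> B - {b0}" "y \<notin> F b"
      using \<open>y \<in> G\<close> unfolding G_def by blast
    have "closest_point (F b) y \<in> F b"
      using b FB F compact_imp_closed by (intro closest_point_in_set) auto
    then have "(dist y (closest_point (F b) y))\<^sup>2 > 0" using b(2) by auto
    then show ?thesis unfolding \<psi>_def using fin b by (intro sum_pos2[of _ b]) auto
  qed
  have "G \<noteq> {}"
  proof -
    have "\<exists>y. (\<Sum>b\<in>B. 1 *\<^sub>R (y - closest_point (F b) y)) = 0"
      using weighted_projection_balance[of B "\<lambda>_. 1" F, OF fin(2) Bne] FB by auto
    then show ?thesis using yG[of "\<lambda>_. 1"] by auto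
  qed
  moreover have "continuous_on G \<psi>"
    unfolding \<psi>_def using F FB compact_imp_closed
    by (intro continuous_intros continuous_on_closest_point) auto
  ultimately obtain y0 where y0: "y0 \<in> G" "\<And>y. y \<in> G \<Longrightarrow> \<psi> y0 \<le> \<psi> y"
    using continuous_attains_inf[OF G] by blast
  \<comment> \<open>A comparison point: it lies in every set of \<open>B\<close> except possibly
    \<open>F b0\<close>, so only the term at \<open>b0\<close> contributes to its weighted
    sum.\<close>
  define z where "z = p a1 b0"
  have z: "z \<in> F b" if "b \<in> B - {b0}" for b
    using that p[OF a1 b0, of b] A(1) a1 by (auto simp: z_def)
  define D where "D = (dist z (closest_point (F b0) z))\<^sup>2"
  \<comment> \<open>Chosen so that \<open>e * D\<close> is at most half the minimum of
    \<open>\<psi>\<close>; the added 1 keeps the denominator positive when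
    \<open>D = 0\<close>.\<close>
  define e where "e = \<psi> y0 / (2 * (D + 1))"
  have D: "D \<ge> 0" by (simp add: D_def)
  have e: "e > 0" using \<psi>pos[OF y0(1)] D by (simp add: e_def)
  have eD: "e * D < \<psi> y0"
  proof -
    have "e * D \<le> e * (D + 1)" using e by simp
    also have "\<dots> = \<psi> y0 / 2" unfolding e_def using D by (simp add: field_simps)
    also have "\<dots> < \<psi> y0" using \<psi>pos[OF y0(1)] by simp
    finally show ?thesis .
  qed
  \<comment> \<open>Balance points lie in \<open>G\<close>. With a weight \<open>e\<close> small at \<open>b0\<close> they get too close to every
    \<open>F b\<close> with \<open>b \<noteq> b0\<close> for the positive minimum of \<open>\<psi>\<close> on \<open>G\<close>.\<close>
  define w where "w = (\<lambda>b. if b = b0 then e else 1)"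
  have w: "b \<in> B \<Longrightarrow> w b > 0" for b using e by (simp add: w_def)
  have split: "(\<Sum>b\<in>B. w b * (dist y (closest_point (F b) y))\<^sup>2)
      = e * (dist y (closest_point (F b0) y))\<^sup>2 + \<psi> y" for y
    using fin b0 by (subst sum.remove[of _ b0]) (auto simp: w_def \<psi>_def intro!: sum.cong)
  have "\<exists>y. (\<Sum>b\<in>B. w b *\<^sub>R (y - closest_point (F b) y)) = 0 \<and>
    (\<forall>b\<in>B. \<forall>z\<in>F b. (\<Sum>b\<in>B. w b * (dist y (closest_point (F b) y))\<^sup>2)
        \<le> (\<Sum>b\<in>B. w b * (dist z (closest_point (F b) z))\<^sup>2))"
    by (rule weighted_projection_balance[OF fin(2) Bne]) (use w FB in auto)
  then obtain y where y: "(\<Sum>b\<in>B. w b *\<^sub>R (y - closest_point (F b) y)) = 0"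
    "\<And>b z. b \<in> B \<Longrightarrow> z \<in> F b \<Longrightarrow>
      (\<Sum>b\<in>B. w b * (dist y (closest_point (F b) y))\<^sup>2)
        \<le> (\<Sum>b\<in>B. w b * (dist z (closest_point (F b) z))\<^sup>2)"
    by (elim exE conjE) simp
  \<comment> \<open>Minimality of \<open>y\<close> is available against points of the sets
    \<open>F b\<close>; \<open>z\<close> is such a point because some \<open>b \<noteq> b0\<close>
    exists.\<close>
  obtain b where b: "b \<in> B" "b \<noteq> b0"
  proof -
    have "B \<noteq> {b0}" using card DIM_positive[where 'a='a] by auto
    then show thesis using b0 that by auto
  qed
  have "\<psi> z = 0"
    unfolding \<psi>_def using z by (intro sum.neutral) (auto simp: closest_point_self)
  have "\<psi> y0 \<le> \<psi> y" using y0(2) yG[OF w y(1)] by simp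
  also have "\<dots> \<le> e * D"
  proof -
    have "e * (dist y (closest_point (F b0) y))\<^sup>2 + \<psi> y \<le> e * D"
      using y(2)[OF b(1), of z] z b unfolding split by (simp add: \<open>\<psi> z = 0\<close> D_def)
    moreover have "e * (dist y (closest_point (F b0) y))\<^sup>2 \<ge> 0" using e by simp
    ultimately show ?thesis by linarith
  qed
  finally show False using eD by simp
qed

subsection \<open>Representable complexes and boxicity\<close>

text \<open>The nerve indexed by the vertices themselves, without relabelling to
  \<open>{1..m}\<close>.\<close>

definition convex_nerve :: "'v set \<Rightarrow> ('v \<Rightarrow> 'a::real_vector set) \<Rightarrow> 'v set set" where
  "convex_nerve V F = {\<sigma>. \<sigma> \<subseteq> V \<and> (\<Inter>v\<in>\<sigma>. F v) \<noteq> {}}"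

text \<open>What \<open>boxicity\<close> demands of each complex in the intersection.\<close>

definition representable_complex :: "'d::finite itself \<Rightarrow> 'v set \<Rightarrow> 'v set set \<Rightarrow> bool" where
  "representable_complex D V Y \<longleftrightarrow> abstract_complex V Y \<and> representable D V Y"

text \<open>Nonempty sets make every element of \<open>V\<close> a vertex of the nerve, as
  \<open>abstract_complex\<close> demands; an enumeration of \<open>V\<close> supplies the labels
  for \<open>nerve\<close>.\<close>

lemma representable_complexI:
  fixes F :: "'v \<Rightarrow> (real ^ 'd::finite) set"
  assumes fin: "finite V" and F: "\<And>v. v \<in> V \<Longrightarrow> compact (F v) \<and> convex (F v) \<and> F v \<noteq> {}"
  shows "representable_complex TYPE('d) V (convex_nerve V F)"
proof -
  obtain h where h: "bij_betw h {1..card V} V"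
    using ex_bij_betw_nat_finite_1[OF fin] by blast
  define f where "f = the_inv_into {1..card V} h"
  have f: "bij_betw f V {1..card V}" unfolding f_def using h by (rule bij_betw_the_inv_into)
  have fh: "f (h i) = i" if "i \<in> {1..card V}" for i
    using h that by (auto simp: f_def bij_betw_def intro: the_inv_into_f_f)
  have hf: "h (f v) = v" if "v \<in> V" for v
    using h that by (auto simp: f_def bij_betw_def intro: f_the_inv_into_f)
  have "nerve (card V) (F \<circ> h) = (\<lambda>\<sigma>. f ` \<sigma>) ` convex_nerve V F"
  proof (intro equalityI subsetI)
    fix \<rho> assume \<rho>: "\<rho> \<in> nerve (card V) (F \<circ> h)"
    then have sub: "\<rho> \<subseteq> {1..card V}" and ne: "(\<Inter>i\<in>\<rho>. F (h i)) \<noteq> {}"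
      by (auto simp: nerve_def)
    have "\<rho> = f ` h ` \<rho>" using sub fh by (force simp: image_image)
    moreover have "h ` \<rho> \<in> convex_nerve V F"
      using sub h ne by (auto simp: convex_nerve_def bij_betw_def)
    ultimately show "\<rho> \<in> (\<lambda>\<sigma>. f ` \<sigma>) ` convex_nerve V F" by blast
  next
    fix \<rho> assume "\<rho> \<in> (\<lambda>\<sigma>. f ` \<sigma>) ` convex_nerve V F"
    then obtain \<sigma> where \<sigma>: "\<sigma> \<subseteq> V" "(\<Inter>v\<in>\<sigma>. F v) \<noteq> {}" "\<rho> = f ` \<sigma>"
      by (auto simp: convex_nerve_def)
    have "(\<Inter>v\<in>\<sigma>. F (h (f v))) = (\<Inter>v\<in>\<sigma>. F v)" using \<sigma>(1) hf by (intro INF_cong) auto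
    moreover have "f ` \<sigma> \<subseteq> {1..card V}"
      using image_mono[OF \<sigma>(1), of f] bij_betw_imp_surj_on[OF f] by simp
    ultimately show "\<rho> \<in> nerve (card V) (F \<circ> h)"
      using \<sigma>(2,3) by (simp add: nerve_def image_image comp_def)
  qed
  moreover have "\<forall>i\<in>{1..card V}. compact ((F \<circ> h) i) \<and> convex ((F \<circ> h) i)"
    using F h by (auto simp: bij_betw_def)
  ultimately have "representable TYPE('d) V (convex_nerve V F)"
    unfolding representable_def complex_iso_def using f by blast
  moreover have "abstract_complex V (convex_nerve V F)"
  proof -
    have "(\<Inter>v\<in>\<tau>. F v) \<noteq> {}" if "(\<Inter>v\<in>\<sigma>. F v) \<noteq> {}" "\<tau> \<subseteq> \<sigma>" for \<sigma> \<tau>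
      using that INF_superset_mono[OF that(2), of F F] by auto
    then show ?thesis
      unfolding abstract_complex_def convex_nerve_def using fin F by (simp add: subset_trans) blast
  qed
  ultimately show ?thesis by (simp add: representable_complex_def)
qed

lemma representable_complexE:
  assumes "representable_complex TYPE('d::finite) V Y"
  obtains F :: "'v \<Rightarrow> (real ^ 'd) set"
    where "\<And>v. v \<in> V \<Longrightarrow> compact (F v)" "\<And>v. v \<in> V \<Longrightarrow> convex (F v)" "Y = convex_nerve V F"
proof -
  obtain m f and F :: "nat \<Rightarrow> (real ^ 'd) set"
    where F: "\<forall>i\<in>{1..m}. compact (F i) \<and> convex (F i)"
      and f: "bij_betw f V {1..m}" and Y: "nerve m F = (\<lambda>\<sigma>. f ` \<sigma>) ` Y"
    using assms unfolding representable_complex_def representable_def complex_iso_def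
    by (elim conjE exE) (rule that; assumption)
  have sub: "Y \<subseteq> Pow V"
    using assms by (simp add: representable_complex_def abstract_complex_def)
  have inj: "inj_on f V" using f by (simp add: bij_betw_def)
  have "\<sigma> \<in> Y \<longleftrightarrow> \<sigma> \<in> convex_nerve V (F \<circ> f)" if \<sigma>: "\<sigma> \<subseteq> V" for \<sigma>
  proof -
    have "\<sigma> \<in> Y \<longleftrightarrow> f ` \<sigma> \<in> nerve m F"
      unfolding Y using sub \<sigma> by (simp add: inj_on_image_mem_iff[OF inj_on_image_Pow[OF inj]])
    also have "\<dots> \<longleftrightarrow> \<sigma> \<in> convex_nerve V (F \<circ> f)"
      using \<sigma> f by (auto simp: nerve_def convex_nerve_def bij_betw_def image_comp)
    finally show ?thesis .
  qed
  then have "Y = convex_nerve V (F \<circ> f)" using sub by (auto simp: convex_nerve_def)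
  moreover have "compact ((F \<circ> f) v)" "convex ((F \<circ> f) v)" if "v \<in> V" for v
    using F f that by (auto simp: bij_betw_def)
  ultimately show thesis by (intro that)
qed

lemma boxicity_le_card:
  assumes "finite \<Y>" "\<And>Y. Y \<in> \<Y> \<Longrightarrow> representable_complex D V Y" "X = Pow V \<inter> \<Inter>\<Y>"
  shows "boxicity D V X \<le> enat (card \<Y>)"
proof -
  obtain h where h: "bij_betw h {0..<card \<Y>} \<Y>"
    using ex_bij_betw_nat_finite[OF assms(1)] by blast
  then have im: "h ` {..<card \<Y>} = \<Y>" by (simp add: bij_betw_def atLeast0LessThan)
  have "X = Pow V \<inter> (\<Inter>i<card \<Y>. h i)" unfolding im by (rule assms(3))
  moreover have "\<forall>i<card \<Y>. abstract_complex V (h i) \<and> representable D V (h i)"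
    using im assms(2) unfolding representable_complex_def by blast
  ultimately show ?thesis
    unfolding boxicity_def by (intro Inf_lower CollectI exI[of _ "card \<Y>"] exI[of _ h] conjI refl)
qed

lemma boxicity_ge:
  assumes "\<And>k Y. (\<And>i. i < k \<Longrightarrow> representable_complex D V (Y i)) \<Longrightarrow>
    X = Pow V \<inter> (\<Inter>i<k. Y i) \<Longrightarrow> b \<le> k"
  shows "enat b \<le> boxicity D V X"
  unfolding boxicity_def
proof (intro Inf_greatest, clarify)
  fix k and Y :: "nat \<Rightarrow> 'a set set"
  assume "\<forall>i<k. abstract_complex V (Y i) \<and> representable D V (Y i)" "X = Pow V \<inter> (\<Inter>i<k. Y i)"
  then show "enat b \<le> enat k"
    using assms[of k Y] by (simp add: representable_complex_def)
qed

section \<open>Missing faces\<close>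

lemma missing_face_subset:
  assumes "finite \<sigma>" "\<sigma> \<subseteq> V" "\<sigma> \<notin> X"
  obtains \<tau> where "\<tau> \<in> missing_faces V X" "\<tau> \<subseteq> \<sigma>"
proof -
  obtain \<tau> where \<tau>: "\<tau> \<in> {\<rho>. \<rho> \<subseteq> \<sigma> \<and> \<rho> \<notin> X}"
    and min: "\<And>\<rho>. \<rho> \<in> {\<rho>. \<rho> \<subseteq> \<sigma> \<and> \<rho> \<notin> X} \<Longrightarrow> \<rho> \<subseteq> \<tau> \<Longrightarrow> \<tau> = \<rho>"
    using finite_has_minimal[of "{\<rho>. \<rho> \<subseteq> \<sigma> \<and> \<rho> \<notin> X}"] assms by auto
  have "\<tau> \<in> missing_faces V X"
    unfolding missing_faces_def using \<tau> min assms(2) by blast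
  then show thesis using that \<tau> by auto
qed

text \<open>A set outside \<open>X\<close> contains a missing face; a complex that omits this face
  omits the whole set, being closed under subsets.\<close>

lemma complex_eq_InterI:
  assumes "abstract_complex V X" "\<And>Y. Y \<in> \<Y> \<Longrightarrow> X \<subseteq> Y"
    and "\<And>Y. Y \<in> \<Y> \<Longrightarrow> abstract_complex V Y"
    and "\<And>\<kappa>. \<kappa> \<in> missing_faces V X \<Longrightarrow> \<exists>Y\<in>\<Y>. \<kappa> \<notin> Y"
  shows "X = Pow V \<inter> \<Inter>\<Y>"
proof (intro equalityI subsetI)
  fix \<sigma> assume \<sigma>: "\<sigma> \<in> Pow V \<inter> \<Inter>\<Y>"
  show "\<sigma> \<in> X"
  proof (rule ccontr)
    assume "\<sigma> \<notin> X"
    moreover have "finite \<sigma>" using \<sigma> assms(1) by (auto simp: abstract_complex_def finite_subset)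
    ultimately obtain \<kappa> where \<kappa>: "\<kappa> \<in> missing_faces V X" "\<kappa> \<subseteq> \<sigma>"
      using \<sigma> missing_face_subset[of \<sigma> V X] by auto
    then obtain Y where "Y \<in> \<Y>" "\<kappa> \<notin> Y" using assms(4) by blast
    then show False using \<sigma> \<kappa> assms(3)[of Y] by (auto simp: abstract_complex_def)
  qed
qed (use assms(1,2) in \<open>auto simp: abstract_complex_def\<close>)

lemma finite_missing_faces: "finite V \<Longrightarrow> finite (missing_faces V X)"
  by (rule finite_subset[of _ "Pow V"]) (auto simp: missing_faces_def)

lemma card_missing_face_le:
  assumes "finite V" "max_missing_dim V X \<le> int d" "\<tau> \<in> missing_faces V X"
  shows "card \<tau> \<le> d + 1"
proof -
  have "int (card \<tau>) - 1 \<le> max_missing_dim V X"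
    unfolding max_missing_dim_def using assms finite_missing_faces by (intro Max_ge) auto
  then show ?thesis using assms by linarith
qed

lemma missing_face_of_max_dim:
  assumes "finite V" "max_missing_dim V X = int d"
  obtains \<tau> where "\<tau> \<in> missing_faces V X" "card \<tau> = d + 1"
proof -
  have "int d \<in> insert (-1) ((\<lambda>\<tau>. int (card \<tau>) - 1) ` missing_faces V X)"
    using Max_in[of "insert (-1) ((\<lambda>\<tau>. int (card \<tau>) - 1) ` missing_faces V X)"]
      finite_missing_faces[OF assms(1)] assms(2)
    by (simp add: max_missing_dim_def)
  \<comment> \<open>Since \<open>int d\<close> is nonnegative it is not the default value -1, so a
    missing face attains it.\<close>
  then show thesis using that by auto
qed

subsection \<open>Complexes excluding the neighbours of a non-face\<close>

text \<open>In a simplex with vertex set indexed by \<open>\<tau>\<close>, \<open>u v \<bullet> x + c v\<close> is the barycentric coordinate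
  of \<open>x\<close> at \<open>v\<close>, and \<open>b \<sigma>\<close> is the barycenter of the face spanned by \<open>\<tau> - \<sigma>\<close>.\<close>

lemma barycenters:
  assumes card: "card \<tau> = CARD('d::finite) + 1"
  shows "\<exists>(b :: 'v set \<Rightarrow> real ^ 'd) u c. \<forall>\<sigma>\<subset>\<tau>.
    (\<forall>v\<in>\<sigma>. u v \<bullet> b \<sigma> + c v = 0) \<and> (\<forall>v\<in>\<tau> - \<sigma>. u v \<bullet> b \<sigma> + c v > 0)"
proof -
  have fin: "finite \<tau>" using card by (metis Suc_eq_plus1 card.infinite nat.distinct(1))
  obtain v0 where v0: "v0 \<in> \<tau>" using card by fastforce
  \<comment> \<open>The simplex is the standard one: \<open>v0\<close> sits at the origin and the
    other elements of \<open>\<tau>\<close>, enumerated by \<open>g\<close>, at the unit vectors.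
    The coordinate at \<open>v0\<close> is therefore 1 minus the sum of the others.\<close>
  have "card (\<tau> - {v0}) = CARD('d)" using card fin v0 by simp
  then obtain g :: "'d \<Rightarrow> 'v" where g: "bij_betw g UNIV (\<tau> - {v0})"
    using finite_same_card_bij[of "UNIV :: 'd set" "\<tau> - {v0}"] fin by auto
  define ix where "ix = the_inv g"
  have ix: "ix (g i) = i" for i
    using g by (simp add: ix_def bij_betw_def the_inv_f_f)
  define b :: "'v set \<Rightarrow> real ^ 'd"
    where "b = (\<lambda>\<sigma>. \<chi> i. if g i \<in> \<sigma> then 0 else 1 / real (card (\<tau> - \<sigma>)))"
  define u :: "'v \<Rightarrow> real ^ 'd" where "u = (\<lambda>v. if v = v0 then (\<chi> i. -1) else axis (ix v) 1)"
  define c :: "'v \<Rightarrow> real" where "c = (\<lambda>v. if v = v0 then 1 else 0)"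
  have val: "u v \<bullet> b \<sigma> + c v = (if v \<in> \<sigma> then 0 else 1 / real (card (\<tau> - \<sigma>)))"
    if \<sigma>: "\<sigma> \<subset> \<tau>" and v: "v \<in> \<tau>" for v \<sigma>
  proof (cases "v = v0")
    case False
    then obtain i where "v = g i" using g v by (auto simp: bij_betw_def)
    then show ?thesis using False by (simp add: u_def c_def b_def ix inner_axis' )
  next
    case True
    have "(\<Sum>i\<in>UNIV. b \<sigma> $ i) = (\<Sum>w\<in>\<tau> - {v0}. if w \<in> \<sigma> then 0 else 1 / real (card (\<tau> - \<sigma>)))"
      using sum.reindex_bij_betw[OF g, of "\<lambda>w. if w \<in> \<sigma> then 0 else 1 / real (card (\<tau> - \<sigma>))"]
      by (simp add: b_def)
    also have "\<dots> = (\<Sum>w\<in>\<tau> - {v0} - \<sigma>. 1 / real (card (\<tau> - \<sigma>)))"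
      using fin by (intro sum.mono_neutral_cong_right) auto
    also have "\<dots> = real (card (\<tau> - \<sigma> - {v0})) / real (card (\<tau> - \<sigma>))"
    proof -
      have "\<tau> - {v0} - \<sigma> = \<tau> - \<sigma> - {v0}" by auto
      then show ?thesis by simp
    qed
    finally have s: "(\<Sum>i\<in>UNIV. b \<sigma> $ i) = real (card (\<tau> - \<sigma> - {v0})) / real (card (\<tau> - \<sigma>))" .
    have ns: "\<not> \<tau> \<subseteq> \<sigma>" using \<sigma> by auto
    have pos: "card (\<tau> - \<sigma>) > 0" using \<sigma> fin by (auto simp: card_gt_0_iff)
    have "u v \<bullet> b \<sigma> + c v = 1 - (\<Sum>i\<in>UNIV. b \<sigma> $ i)"
      using True by (simp add: u_def c_def inner_vec_def sum_negf)
    also have "\<dots> = (if v \<in> \<sigma> then 0 else 1 / real (card (\<tau> - \<sigma>)))"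
      unfolding s using True pos fin v0 ns by (auto simp: card_Diff_singleton of_nat_diff field_simps)
    finally show ?thesis .
  qed
  show ?thesis
  proof (intro exI[of _ b] exI[of _ u] exI[of _ c] allI impI conjI ballI)
    fix \<sigma> v assume "\<sigma> \<subset> \<tau>" "v \<in> \<sigma>"
    then show "u v \<bullet> b \<sigma> + c v = 0" using val[of \<sigma> v] by auto
  next
    fix \<sigma> v assume \<sigma>: "\<sigma> \<subset> \<tau>" "v \<in> \<tau> - \<sigma>"
    then have "card (\<tau> - \<sigma>) > 0" using fin by (auto simp: card_gt_0_iff)
    then show "u v \<bullet> b \<sigma> + c v > 0" using val[of \<sigma> v] \<sigma> by auto
  qed
qed

text \<open>At a point common to the sets of \<open>\<kappa>\<close>, all coordinates in
  \<open>\<kappa> \<inter> \<tau>\<close> vanish. If \<open>w\<close> is the only element of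
  \<open>\<kappa>\<close> outside \<open>\<tau>\<close>, the point is a convex combination of
  barycenters \<open>b \<sigma>\<close> with \<open>\<sigma> \<in> S w\<close>, so some such
  \<open>\<sigma>\<close> contains \<open>\<kappa> \<inter> \<tau>\<close>. Then
  \<open>\<kappa>\<close> lies in the face \<open>insert w \<sigma>\<close>.\<close>

lemma excluding_complex:
  assumes X: "abstract_complex V X" and \<tau>: "\<tau> \<subseteq> V" "\<tau> \<notin> X" and card: "card \<tau> = CARD('d::finite) + 1"
  obtains Y where "representable_complex TYPE('d) V Y" "X \<subseteq> Y"
    and "\<And>\<kappa>. \<kappa> \<subseteq> V \<Longrightarrow> \<kappa> \<notin> X \<Longrightarrow> card (\<kappa> - \<tau>) \<le> 1 \<Longrightarrow> \<kappa> \<notin> Y"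
proof -
  have fin: "finite V" "finite \<tau>" and down: "\<And>\<sigma> \<rho>. \<sigma> \<in> X \<Longrightarrow> \<rho> \<subseteq> \<sigma> \<Longrightarrow> \<rho> \<in> X"
    and vert: "\<And>v. v \<in> V \<Longrightarrow> {v} \<in> X" and XV: "\<And>\<sigma>. \<sigma> \<in> X \<Longrightarrow> \<sigma> \<subseteq> V"
    using X \<tau> by (auto simp: abstract_complex_def finite_subset)
  obtain b :: "'a set \<Rightarrow> real ^ 'd" and u c where b: "\<forall>\<sigma>\<subset>\<tau>.
      (\<forall>v\<in>\<sigma>. u v \<bullet> b \<sigma> + c v = 0) \<and> (\<forall>v\<in>\<tau> - \<sigma>. u v \<bullet> b \<sigma> + c v > 0)"
    using barycenters[OF card] by (elim exE) (rule that)
  then have b0: "\<And>\<sigma> v. \<sigma> \<subset> \<tau> \<Longrightarrow> v \<in> \<sigma> \<Longrightarrow> u v \<bullet> b \<sigma> + c v = 0"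
    and bpos: "\<And>\<sigma> v. \<sigma> \<subset> \<tau> \<Longrightarrow> v \<in> \<tau> - \<sigma> \<Longrightarrow> u v \<bullet> b \<sigma> + c v > 0"
    by simp_all
  \<comment> \<open>The last clause places \<open>F v\<close>, for \<open>v \<in> \<tau>\<close>, in
    the facet opposite \<open>v\<close>. Every such \<open>\<sigma>\<close> is a face of
    \<open>X\<close> and so differs from \<open>\<tau>\<close>, which makes the face spanned by
    \<open>\<tau> - \<sigma>\<close> nonempty.\<close>
  define S where "S = (\<lambda>v. {\<sigma>. \<sigma> \<subseteq> \<tau> \<and> insert v \<sigma> \<in> X \<and> (v \<in> \<tau> \<longrightarrow> v \<in> \<sigma>)})"
  define F where "F = (\<lambda>v. convex hull (b ` S v))"
  have S: "\<sigma> \<subset> \<tau>" "\<sigma> \<in> X" if "\<sigma> \<in> S v" for \<sigma> v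
    using that \<tau>(2) down[of "insert v \<sigma>" \<sigma>] by (auto simp: S_def)
  have finS: "finite (S v)" for v
    using fin(2) by (auto simp: S_def intro: finite_subset[of _ "Pow \<tau>"])
  have Sne: "S v \<noteq> {}" if "v \<in> V" for v
  proof -
    \<comment> \<open>The intersection treats \<open>v \<in> \<tau>\<close> and
      \<open>v \<notin> \<tau>\<close> at once.\<close>
    have "insert v ({v} \<inter> \<tau>) = {v}" by auto
    then have "insert v ({v} \<inter> \<tau>) \<in> X" using vert[OF that] by (simp only:)
    then have "{v} \<inter> \<tau> \<in> S v" unfolding S_def by blast
    then show ?thesis by blast
  qed
  have face: "u v \<bullet> x + c v \<le> 0" if "v \<in> \<tau>" "x \<in> F v" for v x
  proof -
    have "F v \<subseteq> {x. u v \<bullet> x \<le> - c v}"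
      unfolding F_def
    proof (intro hull_minimal convex_halfspace_le subsetI)
      fix y assume "y \<in> b ` S v"
      then obtain \<sigma> where \<sigma>: "\<sigma> \<in> S v" "y = b \<sigma>" by auto
      then have "v \<in> \<sigma>" using that(1) by (simp add: S_def)
      then show "y \<in> {x. u v \<bullet> x \<le> - c v}" using b0[OF S(1)[OF \<sigma>(1)], of v] \<sigma>(2) by simp
    qed
    then show ?thesis using that(2) by auto
  qed
  \<comment> \<open>The sum of the coordinates at \<open>\<rho>\<close> is affine, and positive at
    each \<open>b \<sigma>\<close> whose \<open>\<sigma>\<close> misses an element of
    \<open>\<rho>\<close>. If all generators of \<open>F w\<close> were of this kind, it would be
    positive on \<open>F w\<close>, but it is nonpositive at \<open>x\<close>.\<close>
  have gen: "\<exists>\<sigma>\<in>S w. \<rho> \<subseteq> \<sigma>"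
    if \<rho>: "\<rho> \<subseteq> \<tau>" and x: "x \<in> F w" "\<And>v. v \<in> \<rho> \<Longrightarrow> u v \<bullet> x + c v \<le> 0" for \<rho> x w
  proof (rule ccontr)
    assume no: "\<not> ?thesis"
    have eq: "(\<Sum>v\<in>\<rho>. u v \<bullet> y + c v) = (\<Sum>v\<in>\<rho>. u v) \<bullet> y + (\<Sum>v\<in>\<rho>. c v)" for y
      by (simp add: sum.distrib inner_sum_left)
    have "F w \<subseteq> {y. (\<Sum>v\<in>\<rho>. u v) \<bullet> y > - (\<Sum>v\<in>\<rho>. c v)}"
      unfolding F_def
    proof (intro hull_minimal convex_halfspace_gt subsetI)
      fix y assume "y \<in> b ` S w"
      then obtain \<sigma> where \<sigma>: "\<sigma> \<in> S w" "y = b \<sigma>" by auto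
      then obtain v where v: "v \<in> \<rho>" "v \<notin> \<sigma>" using no by blast
      have "(\<Sum>v\<in>\<rho>. u v \<bullet> y + c v) > 0"
      proof (rule sum_pos2[of _ v])
        show "finite \<rho>" using \<rho> fin(2) by (rule finite_subset)
        show "0 < u v \<bullet> y + c v" using v \<rho> bpos[OF S(1)[OF \<sigma>(1)]] \<sigma>(2) by auto
        show "0 \<le> u a \<bullet> y + c a" if "a \<in> \<rho>" for a
          using that \<rho> bpos[OF S(1)[OF \<sigma>(1)], of a] b0[OF S(1)[OF \<sigma>(1)], of a] \<sigma>(2)
          by (cases "a \<in> \<sigma>") auto
      qed fact
      then show "y \<in> {y. (\<Sum>v\<in>\<rho>. u v) \<bullet> y > - (\<Sum>v\<in>\<rho>. c v)}" unfolding eq by simp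
    qed
    then have "(\<Sum>v\<in>\<rho>. u v \<bullet> x + c v) > 0" using x(1) unfolding eq by auto
    moreover have "(\<Sum>v\<in>\<rho>. u v \<bullet> x + c v) \<le> 0" using x(2) by (rule sum_nonpos)
    ultimately show False by simp
  qed
  show thesis
  proof (rule that[of "convex_nerve V F"])
    show "representable_complex TYPE('d) V (convex_nerve V F)"
      using fin(1) Sne finS
      by (intro representable_complexI)
        (auto simp: F_def finite_imp_compact_convex_hull)
    show "X \<subseteq> convex_nerve V F"
    proof
      fix \<rho> assume \<rho>: "\<rho> \<in> X"
      have "b (\<rho> \<inter> \<tau>) \<in> F v" if "v \<in> \<rho>" for v
      proof -
        have "\<rho> \<inter> \<tau> \<in> S v" using that down[OF \<rho>, of "insert v (\<rho> \<inter> \<tau>)"] by (auto simp: S_def)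
        then show ?thesis by (auto simp: F_def intro: hull_inc)
      qed
      then show "\<rho> \<in> convex_nerve V F" using XV[OF \<rho>] by (auto simp: convex_nerve_def)
    qed
  next
    fix \<kappa> assume \<kappa>: "\<kappa> \<subseteq> V" "\<kappa> \<notin> X" "card (\<kappa> - \<tau>) \<le> 1"
    show "\<kappa> \<notin> convex_nerve V F"
    proof
      assume "\<kappa> \<in> convex_nerve V F"
      then obtain x where x: "\<And>v. v \<in> \<kappa> \<Longrightarrow> x \<in> F v" by (auto simp: convex_nerve_def)
      have "\<kappa> \<noteq> {}" using \<kappa>(2) X by (auto simp: abstract_complex_def)
      have "finite (\<kappa> - \<tau>)" using \<kappa>(1) fin(1) finite_subset by blast
      \<comment> \<open>If \<open>\<kappa>\<close> lies inside \<open>\<tau>\<close>, any of its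
        elements serves as \<open>w\<close>.\<close>
      then obtain w where w: "w \<in> \<kappa>" "\<kappa> - \<tau> \<subseteq> {w}"
        using \<kappa>(3) \<open>\<kappa> \<noteq> {}\<close> by (auto simp: le_Suc_eq card_1_singleton_iff)
      obtain \<sigma> where \<sigma>: "\<sigma> \<in> S w" "\<kappa> \<inter> \<tau> \<subseteq> \<sigma>"
        using gen[of "\<kappa> \<inter> \<tau>" x w] x face w(1) by auto
      then have "\<kappa> \<subseteq> insert w \<sigma>" using w by auto
      moreover have "insert w \<sigma> \<in> X" using \<sigma>(1) by (simp add: S_def)
      ultimately show False using down \<kappa>(2) by blast
    qed
  qed
qed

subsection \<open>Packings and Steiner systems\<close>

definition shadow :: "nat \<Rightarrow> 'v set set \<Rightarrow> 'v set set" where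
  "shadow d P = (\<Union>\<tau>\<in>P. {\<eta>. \<eta> \<subseteq> \<tau> \<and> card \<eta> = d})"

text \<open>Each member has \<open>d + 1\<close> subsets of size \<open>d\<close>, and no two
  members share one.\<close>

lemma card_shadow:
  assumes "finite P" "\<And>\<tau>. \<tau> \<in> P \<Longrightarrow> card \<tau> = d + 1"
    and "\<And>\<tau> \<rho> \<eta>. \<tau> \<in> P \<Longrightarrow> \<rho> \<in> P \<Longrightarrow> \<eta> \<subseteq> \<tau> \<Longrightarrow> \<eta> \<subseteq> \<rho> \<Longrightarrow> card \<eta> = d \<Longrightarrow> \<tau> = \<rho>"
  shows "card (shadow d P) = card P * (d + 1)"
proof -
  have fin: "finite \<tau>" if "\<tau> \<in> P" for \<tau>
    using assms(2)[OF that] by (metis Suc_eq_plus1 card.infinite nat.distinct(1))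
  have "card (shadow d P) = (\<Sum>\<tau>\<in>P. card {\<eta>. \<eta> \<subseteq> \<tau> \<and> card \<eta> = d})"
    unfolding shadow_def
  proof (rule card_UN_disjoint)
    show "\<forall>\<tau>\<in>P. finite {\<eta>. \<eta> \<subseteq> \<tau> \<and> card \<eta> = d}" using fin by auto
    show "\<forall>\<tau>\<in>P. \<forall>\<rho>\<in>P. \<tau> \<noteq> \<rho> \<longrightarrow>
        {\<eta>. \<eta> \<subseteq> \<tau> \<and> card \<eta> = d} \<inter> {\<eta>. \<eta> \<subseteq> \<rho> \<and> card \<eta> = d} = {}"
      using assms(3) by blast
  qed (rule assms(1))
  also have "\<dots> = (\<Sum>\<tau>\<in>P. d + 1)"
    using assms(2) fin by (intro sum.cong refl) (simp add: n_subsets)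
  finally show ?thesis by simp
qed

lemma shadow_subset:
  assumes "\<And>\<tau>. \<tau> \<in> P \<Longrightarrow> \<tau> \<subseteq> V"
  shows "shadow d P \<subseteq> {\<eta>. \<eta> \<subseteq> V \<and> card \<eta> = d}"
  using assms by (auto simp: shadow_def)

text \<open>For members of size \<open>d + 1\<close> these are the partial Steiner systems: no
  \<open>d\<close>-set lies in two members.\<close>

definition packing :: "nat \<Rightarrow> 'v set set \<Rightarrow> bool" where
  "packing d P \<longleftrightarrow> pairwise (\<lambda>\<sigma> \<tau>. card (\<sigma> \<inter> \<tau>) < d) P"

lemma maximal_packing_exists:
  assumes "finite N" and "\<And>\<tau>. \<tau> \<in> N \<Longrightarrow> d \<le> card \<tau>"
  obtains P where "P \<subseteq> N" "packing d P" "\<And>\<rho>. \<rho> \<in> N \<Longrightarrow> \<exists>\<tau>\<in>P. d \<le> card (\<rho> \<inter> \<tau>)"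
proof -
  have "finite {P. P \<subseteq> N \<and> packing d P}" using assms(1) by simp
  moreover have "{} \<in> {P. P \<subseteq> N \<and> packing d P}" by (simp add: packing_def)
  ultimately have "\<exists>P\<in>{P. P \<subseteq> N \<and> packing d P}. \<forall>Q\<in>{P. P \<subseteq> N \<and> packing d P}. P \<subseteq> Q \<longrightarrow> P = Q"
    by (intro finite_has_maximal) auto
  then obtain P where P: "P \<subseteq> N" "packing d P"
    and max: "\<forall>Q\<in>{P. P \<subseteq> N \<and> packing d P}. P \<subseteq> Q \<longrightarrow> P = Q"
    by auto
  have "\<exists>\<tau>\<in>P. d \<le> card (\<rho> \<inter> \<tau>)" if \<rho>: "\<rho> \<in> N" for \<rho>
  proof (rule ccontr)
    assume no: "\<not> ?thesis"
    then have "packing d (insert \<rho> P)"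
      using P(2) by (force simp: packing_def pairwise_insert Int_commute)
    then have "P = insert \<rho> P" using P(1) \<rho> bspec[OF max, of "insert \<rho> P"] by blast
    then have "\<rho> \<in> P" by blast
    \<comment> \<open>\<open>\<rho>\<close> would itself be a member meeting \<open>\<rho>\<close>
      in at least \<open>d\<close> elements.\<close>
    then show False using no assms(2)[OF \<rho>] by force
  qed
  then show thesis using P that by blast
qed

lemma packing_eqI:
  assumes "packing d P" "\<tau> \<in> P" "\<rho> \<in> P" "finite \<tau>" "\<eta> \<subseteq> \<tau>" "\<eta> \<subseteq> \<rho>" "card \<eta> = d"
  shows "\<tau> = \<rho>"
proof (rule ccontr)
  assume "\<tau> \<noteq> \<rho>"
  then have "card (\<tau> \<inter> \<rho>) < d" using assms(1-3) by (auto simp: packing_def pairwise_def)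
  moreover have "card \<eta> \<le> card (\<tau> \<inter> \<rho>)" using assms by (intro card_mono) auto
  ultimately show False using assms(7) by simp
qed

lemma card_Diff_le_1I:
  assumes "card \<rho> = d + 1" "d \<le> card (\<rho> \<inter> \<tau>)"
  shows "card (\<rho> - \<tau>) \<le> 1"
proof -
  have "finite \<rho>" using assms(1) by (metis Suc_eq_plus1 card.infinite nat.distinct(1))
  then show ?thesis using assms by (simp add: card_Diff_subset_Int)
qed

text \<open>Each member contributes its own \<open>d + 1\<close> sets to the shadow, which consists
  of \<open>d\<close>-subsets of \<open>V\<close>. Equality means that the shadow is all of
  them.\<close>

lemma card_packing:
  assumes "finite V" and P: "\<And>\<tau>. \<tau> \<in> P \<Longrightarrow> \<tau> \<subseteq> V \<and> card \<tau> = d + 1" "packing d P"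
  shows "card P * (d + 1) \<le> card V choose d"
    and "card P * (d + 1) = card V choose d \<Longrightarrow> \<eta> \<subseteq> V \<Longrightarrow> card \<eta> = d \<Longrightarrow> \<exists>\<tau>\<in>P. \<eta> \<subseteq> \<tau>"
proof -
  have sub: "shadow d P \<subseteq> {\<eta>. \<eta> \<subseteq> V \<and> card \<eta> = d}" using P by (intro shadow_subset) auto
  have fin: "finite {\<eta>. \<eta> \<subseteq> V \<and> card \<eta> = d}" using assms(1) by simp
  have card: "card (shadow d P) = card P * (d + 1)"
  proof (rule card_shadow)
    show "finite P" using P assms(1) by (intro finite_subset[of P "Pow V"]) auto
    show "\<tau> = \<rho>" if "\<tau> \<in> P" "\<rho> \<in> P" "\<eta> \<subseteq> \<tau>" "\<eta> \<subseteq> \<rho>" "card \<eta> = d" for \<tau> \<rho> \<eta>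
    proof -
      have "finite \<tau>" using P(1)[OF that(1)] assms(1) finite_subset by blast
      then show ?thesis by (rule packing_eqI[OF P(2) that(1,2) _ that(3-5)])
    qed
  qed (use P in auto)
  show "card P * (d + 1) \<le> card V choose d"
    using card_mono[OF fin sub] assms(1) by (simp add: card n_subsets)
  show "\<exists>\<tau>\<in>P. \<eta> \<subseteq> \<tau>" if "card P * (d + 1) = card V choose d" "\<eta> \<subseteq> V" "card \<eta> = d"
  proof -
    have "shadow d P = {\<eta>. \<eta> \<subseteq> V \<and> card \<eta> = d}"
      using that(1) assms(1) by (intro card_subset_eq[OF fin sub]) (simp add: card n_subsets)
    then have "\<eta> \<in> shadow d P" using that by simp
    then show ?thesis by (auto simp: shadow_def)
  qed
qed

text \<open>Two blocks with \<open>d\<close> common elements would violate uniqueness; existence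
  makes the shadow the family of all \<open>d\<close>-subsets, and counting it counts the
  blocks.\<close>

lemma steiner_system_packing:
  assumes "finite V" "steiner_system d (d + 1) V S"
  shows "packing d S" "card S * (d + 1) = card V choose d"
proof -
  have S: "\<And>B. B \<in> S \<Longrightarrow> B \<subseteq> V \<and> card B = d + 1"
    and ex1: "\<And>T. T \<subseteq> V \<Longrightarrow> card T = d \<Longrightarrow> \<exists>!B. B \<in> S \<and> T \<subseteq> B"
    using assms(2) unfolding steiner_system_def by simp_all
  have uniq: "B = C" if "B \<in> S" "C \<in> S" "T \<subseteq> B" "T \<subseteq> C" "card T = d" for B C T
    using ex1[of T] S[OF that(1)] that by blast
  show "packing d S"
    unfolding packing_def pairwise_def
  proof (intro ballI impI)
    fix B C assume BC: "B \<in> S" "C \<in> S" "B \<noteq> C"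
    show "card (B \<inter> C) < d"
    proof (rule ccontr)
      assume "\<not> card (B \<inter> C) < d"
      then obtain T where "T \<subseteq> B \<inter> C" "card T = d"
        using obtain_subset_with_card_n[of d "B \<inter> C"] by (metis not_less)
      then show False using uniq[of B C T] BC by auto
    qed
  qed
  have "shadow d S = {\<eta>. \<eta> \<subseteq> V \<and> card \<eta> = d}"
  proof
    show "shadow d S \<subseteq> {\<eta>. \<eta> \<subseteq> V \<and> card \<eta> = d}" using S by (intro shadow_subset) auto
    show "{\<eta>. \<eta> \<subseteq> V \<and> card \<eta> = d} \<subseteq> shadow d S"
    proof
      fix \<eta> assume \<eta>: "\<eta> \<in> {\<eta>. \<eta> \<subseteq> V \<and> card \<eta> = d}"
      then have "\<exists>B. B \<in> S \<and> \<eta> \<subseteq> B" using ex1[of \<eta>] by (auto elim: ex1_implies_ex)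
      then show "\<eta> \<in> shadow d S" using \<eta> by (auto simp: shadow_def)
    qed
  qed
  moreover have "card (shadow d S) = card S * (d + 1)"
  proof (rule card_shadow)
    show "finite S" using S assms(1) by (intro finite_subset[of S "Pow V"]) auto
    show "card \<tau> = d + 1" if "\<tau> \<in> S" for \<tau> using S[OF that] by simp
    show "\<tau> = \<rho>" if "\<tau> \<in> S" "\<rho> \<in> S" "\<eta> \<subseteq> \<tau>" "\<eta> \<subseteq> \<rho>" "card \<eta> = d" for \<tau> \<rho> \<eta>
      by (rule uniq[OF that])
  qed
  ultimately show "card S * (d + 1) = card V choose d" using assms(1) by (simp add: n_subsets)
qed

subsection \<open>Bounds on the boxicity\<close>

text \<open>Intersect one excluding complex for each \<open>\<tau> \<in> T\<close> with the
  additional complexes \<open>\<Z>\<close>. The upper bound takes \<open>\<Z>\<close> empty; the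
  strict inequality takes one extra complex in exchange for two members of a packing.\<close>

lemma boxicity_le_cover:
  assumes X: "abstract_complex V X" and T: "finite T"
    "\<And>\<tau>. \<tau> \<in> T \<Longrightarrow> \<tau> \<subseteq> V \<and> \<tau> \<notin> X \<and> card \<tau> = CARD('d::finite) + 1"
    and \<Z>: "finite \<Z>" "\<And>Z. Z \<in> \<Z> \<Longrightarrow> representable_complex TYPE('d) V Z \<and> X \<subseteq> Z"
    and cover: "\<And>\<kappa>. \<kappa> \<in> missing_faces V X \<Longrightarrow>
      (\<exists>\<tau>\<in>T. card (\<kappa> - \<tau>) \<le> 1) \<or> (\<exists>Z\<in>\<Z>. \<kappa> \<notin> Z)"
  shows "boxicity TYPE('d) V X \<le> enat (card T + card \<Z>)"
proof -
  have "\<forall>\<tau>\<in>T. \<exists>Y. representable_complex TYPE('d) V Y \<and> X \<subseteq> Y \<and>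
      (\<forall>\<kappa>. \<kappa> \<subseteq> V \<longrightarrow> \<kappa> \<notin> X \<longrightarrow> card (\<kappa> - \<tau>) \<le> 1 \<longrightarrow> \<kappa> \<notin> Y)"
  proof
    fix \<tau> assume "\<tau> \<in> T"
    then have "\<tau> \<subseteq> V" "\<tau> \<notin> X" "card \<tau> = CARD('d) + 1" using T(2) by auto
    then obtain Y where "representable_complex TYPE('d) V Y" "X \<subseteq> Y"
      "\<And>\<kappa>. \<kappa> \<subseteq> V \<Longrightarrow> \<kappa> \<notin> X \<Longrightarrow> card (\<kappa> - \<tau>) \<le> 1 \<Longrightarrow> \<kappa> \<notin> Y"
      using excluding_complex[OF X] by metis
    then show "\<exists>Y. representable_complex TYPE('d) V Y \<and> X \<subseteq> Y \<and>
      (\<forall>\<kappa>. \<kappa> \<subseteq> V \<longrightarrow> \<kappa> \<notin> X \<longrightarrow> card (\<kappa> - \<tau>) \<le> 1 \<longrightarrow> \<kappa> \<notin> Y)" by (intro exI[of _ Y]) simp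
  qed
  then obtain Y where Y: "\<And>\<tau>. \<tau> \<in> T \<Longrightarrow> representable_complex TYPE('d) V (Y \<tau>)"
    "\<And>\<tau>. \<tau> \<in> T \<Longrightarrow> X \<subseteq> Y \<tau>"
    "\<And>\<tau> \<kappa>. \<tau> \<in> T \<Longrightarrow> \<kappa> \<subseteq> V \<Longrightarrow> \<kappa> \<notin> X \<Longrightarrow> card (\<kappa> - \<tau>) \<le> 1 \<Longrightarrow> \<kappa> \<notin> Y \<tau>"
    by (metis (no_types, lifting))
  have rep: "representable_complex TYPE('d) V Z" "X \<subseteq> Z" if "Z \<in> Y ` T \<union> \<Z>" for Z
    using that Y(1,2) \<Z>(2) by blast+
  have "X = Pow V \<inter> \<Inter>(Y ` T \<union> \<Z>)"
  proof (rule complex_eq_InterI[OF X])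
    fix \<kappa> assume \<kappa>: "\<kappa> \<in> missing_faces V X"
    then have "\<kappa> \<subseteq> V" "\<kappa> \<notin> X" by (auto simp: missing_faces_def)
    then show "\<exists>Z\<in>Y ` T \<union> \<Z>. \<kappa> \<notin> Z" using cover[OF \<kappa>] Y(3) by blast
  qed (use rep in \<open>auto simp: representable_complex_def\<close>)
  then have "boxicity TYPE('d) V X \<le> enat (card (Y ` T \<union> \<Z>))"
    using T(1) \<Z>(1) rep(1) by (intro boxicity_le_card) auto
  also have "card (Y ` T \<union> \<Z>) \<le> card T + card \<Z>"
    using card_Un_le[of "Y ` T" \<Z>] card_image_le[OF T(1), of Y] by linarith
  finally show ?thesis by simp
qed

section \<open>The lower bound for Steiner systems\<close>

lemma Helly_indexed:
  fixes F :: "'v \<Rightarrow> 'a::euclidean_space set"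
  assumes fin: "finite \<sigma>" and conv: "\<And>v. v \<in> \<sigma> \<Longrightarrow> convex (F v)" and empty: "(\<Inter>v\<in>\<sigma>. F v) = {}"
  shows "\<exists>\<rho>\<subseteq>\<sigma>. card \<rho> \<le> DIM('a) + 1 \<and> (\<Inter>v\<in>\<rho>. F v) = {}"
proof -
  have "\<exists>\<G>\<subseteq>F ` \<sigma>. card \<G> \<le> DIM('a) + 1 \<and> \<Inter>\<G> = {}"
  proof (cases "card (F ` \<sigma>) \<ge> DIM('a) + 1")
    case True
    show ?thesis
    proof (rule ccontr)
      assume no: "\<not> ?thesis"
      have "\<Inter>(F ` \<sigma>) \<noteq> {}"
      proof (rule Helly[OF True])
        show "\<forall>s\<in>F ` \<sigma>. convex s" using conv by auto
        show "\<Inter>t \<noteq> {}" if "t \<subseteq> F ` \<sigma>" "card t = DIM('a) + 1" for t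
          using no that by auto
      qed
      then show False using empty by simp
    qed
  next
    case False
    then show ?thesis using empty by (intro exI[of _ "F ` \<sigma>"]) simp
  qed
  then obtain \<G> where \<G>: "\<G> \<subseteq> F ` \<sigma>" "card \<G> \<le> DIM('a) + 1" "\<Inter>\<G> = {}" by blast
  \<comment> \<open>Different indices may carry the same set; choosing one index for each set of
    \<open>\<G>\<close> keeps the bound on the size.\<close>
  then obtain \<rho> where \<rho>: "\<rho> \<subseteq> \<sigma>" "inj_on F \<rho>" "\<G> = F ` \<rho>"
    unfolding subset_image_inj by blast
  then show ?thesis using \<G> by (intro exI[of _ \<rho>]) (simp add: card_image)
qed

text \<open>Two distinct excluded blocks \<open>B\<close>, \<open>C\<close> with smallest union
  satisfy the hypotheses of \<open>intersection_omitting_one\<close> with \<open>A = C - B\<close>.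
  Omitting some \<open>b0\<close> in \<open>B - C\<close> leaves all of \<open>C\<close>, whose sets
  then have a common point.\<close>

lemma representable_superset_excludes_one_block:
  assumes X: "abstract_complex V X"
    and S: "steiner_system CARD('d::finite) (CARD('d) + 1) V (missing_faces V X)"
    and Y: "representable_complex TYPE('d) V Y" "X \<subseteq> Y"
    and \<tau>: "\<tau> \<in> missing_faces V X" "\<tau>' \<in> missing_faces V X" "\<tau> \<notin> Y" "\<tau>' \<notin> Y"
  shows "\<tau> = \<tau>'"
proof (rule ccontr)
  assume "\<tau> \<noteq> \<tau>'"
  let ?M = "missing_faces V X" and ?d = "CARD('d)"
  have fin: "finite V" using X by (simp add: abstract_complex_def)
  have pack: "packing ?d ?M" by (rule steiner_system_packing[OF fin S])
  have M: "B \<subseteq> V" "card B = ?d + 1" "finite B" if "B \<in> ?M" for B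
  proof -
    show "B \<subseteq> V" using that by (simp add: missing_faces_def)
    then show "finite B" using fin by (rule finite_subset)
    show "card B = ?d + 1" using S that by (simp add: steiner_system_def)
  qed
  define bad where "bad = (\<lambda>(B, C). B \<in> ?M \<and> C \<in> ?M \<and> B \<notin> Y \<and> C \<notin> Y \<and> B \<noteq> C)"
  have "bad (\<tau>, \<tau>')" using \<tau> \<open>\<tau> \<noteq> \<tau>'\<close> by (simp add: bad_def)
  then obtain z where z: "bad z"
    "\<And>z'. bad z' \<Longrightarrow> card (fst z \<union> snd z) \<le> card (fst z' \<union> snd z')"
    using ex_has_least_nat[of bad "(\<tau>, \<tau>')" "\<lambda>z. card (fst z \<union> snd z)"] by auto
  obtain B C where BC: "z = (B, C)" by fastforce
  have B: "B \<in> ?M" "B \<notin> Y" and C: "C \<in> ?M" "C \<notin> Y" and "B \<noteq> C"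
    using z(1) BC by (auto simp: bad_def)
  have min: "card (B \<union> C) \<le> card (B \<union> D)" if "D \<in> ?M" "D \<notin> Y" "D \<noteq> B" for D
    using z(2)[of "(B, D)"] that B BC by (simp add: bad_def)
  obtain F :: "'a \<Rightarrow> (real ^ 'd) set" where
    F: "\<And>v. v \<in> V \<Longrightarrow> compact (F v)" "\<And>v. v \<in> V \<Longrightarrow> convex (F v)" and YF: "Y = convex_nerve V F"
    by (rule representable_complexE[OF Y(1)]) (rule that)
  have notin: "\<sigma> \<notin> Y \<longleftrightarrow> (\<Inter>v\<in>\<sigma>. F v) = {}" if "\<sigma> \<subseteq> V" for \<sigma>
    using that by (simp add: YF convex_nerve_def)
  have "card (C \<inter> B) < ?d" using pack B C \<open>B \<noteq> C\<close> by (auto simp: packing_def pairwise_def)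
  \<comment> \<open>Two blocks share fewer than \<open>d\<close> of their \<open>d + 1\<close>
    elements.\<close>
  then have A2: "card (C - B) \<ge> 2" using M[OF C(1)] by (simp add: card_Diff_subset_Int)
  have "\<not> B \<subseteq> C" using card_subset_eq[of C B] M[OF B(1)] M[OF C(1)] \<open>B \<noteq> C\<close> by auto
  then obtain b0 where b0: "b0 \<in> B" "b0 \<notin> C" by blast
  have sub: "(C - B) \<union> B \<subseteq> V" using M B C by auto
  have "(\<Inter>v\<in>(C - B) \<union> B - {b0}. F v) \<noteq> {}"
  proof (rule intersection_omitting_one)
    show "(C - B) \<inter> B = {}" by auto
    show "card B = DIM(real ^ 'd) + 1" using M(2)[OF B(1)] by simp
    show "(\<Inter>b\<in>B. F b) = {}" using notin[OF M(1)[OF B(1)]] B(2) by simp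
    fix a b assume ab: "a \<in> C - B" "b \<in> B"
    show "(\<Inter>v\<in>(C - B) \<union> B - {a, b}. F v) \<noteq> {}"
    proof
      \<comment> \<open>By Helly at most \<open>d + 1\<close> of these sets already have empty
        intersection; their index set contains a block \<open>D\<close> and, by size, equals it.
        This excluded block omits \<open>b\<close>, so differs from \<open>B\<close>, and omits
        \<open>a\<close>, so its union with \<open>B\<close> is smaller than
        \<open>B \<union> C\<close>.\<close>
      assume empty: "(\<Inter>v\<in>(C - B) \<union> B - {a, b}. F v) = {}"
      have "finite ((C - B) \<union> B - {a, b})" using M B C by auto
      moreover have "convex (F v)" if "v \<in> (C - B) \<union> B - {a, b}" for v using that sub F by auto
      ultimately have "\<exists>\<rho>\<subseteq>(C - B) \<union> B - {a, b}. card \<rho> \<le> DIM(real ^ 'd) + 1 \<and> (\<Inter>v\<in>\<rho>. F v) = {}"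
        using empty by (rule Helly_indexed)
      then obtain \<rho> where \<rho>: "\<rho> \<subseteq> (C - B) \<union> B - {a, b}" "card \<rho> \<le> DIM(real ^ 'd) + 1"
        "(\<Inter>v\<in>\<rho>. F v) = {}"
        by (elim exE conjE) (rule that)
      have "\<rho> \<subseteq> V" using \<rho>(1) sub by auto
      then have \<rho>V: "\<rho> \<subseteq> V" "finite \<rho>" using fin finite_subset by auto
      have "\<rho> \<notin> Y" using notin[OF \<rho>V(1)] \<rho>(3) by simp
      then obtain D where D: "D \<in> ?M" "D \<subseteq> \<rho>"
        using missing_face_subset[OF \<rho>V(2,1)] Y(2) by blast
      then have "D = \<rho>" using M(2)[OF D(1)] \<rho>(2) card_seteq[OF \<rho>V(2) D(2)] by simp
      have "D \<noteq> B" using \<rho>(1) ab(2) \<open>D = \<rho>\<close> by auto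
      then have "card (B \<union> C) \<le> card (B \<union> D)"
        using min D \<open>D = \<rho>\<close> \<open>\<rho> \<notin> Y\<close> by auto
      moreover have "card (B \<union> D) < card (B \<union> C)"
        using \<rho>(1) ab \<open>D = \<rho>\<close> M B C by (intro psubset_card_mono) auto
      ultimately show False by simp
    qed
  qed (use A2 F sub b0 in auto)
  moreover have "C \<subseteq> (C - B) \<union> B - {b0}" using b0 by auto
  ultimately have "(\<Inter>v\<in>C. F v) \<noteq> {}" by blast
  then show False using notin[OF M(1)[OF C(1)]] C(2) by simp
qed

text \<open>Each block is excluded by one of the complexes, and no complex excludes two
  blocks.\<close>

lemma boxicity_ge_steiner:
  assumes X: "abstract_complex V X"
    and S: "steiner_system CARD('d::finite) (CARD('d) + 1) V (missing_faces V X)"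
  shows "enat (card (missing_faces V X)) \<le> boxicity TYPE('d) V X"
proof (rule boxicity_ge)
  fix k and Y :: "nat \<Rightarrow> 'a set set"
  assume Y: "\<And>i. i < k \<Longrightarrow> representable_complex TYPE('d) V (Y i)" "X = Pow V \<inter> (\<Inter>i<k. Y i)"
  have "\<forall>\<tau>\<in>missing_faces V X. \<exists>i<k. \<tau> \<notin> Y i"
    using Y(2) by (auto simp: missing_faces_def)
  then obtain i where i: "\<And>\<tau>. \<tau> \<in> missing_faces V X \<Longrightarrow> i \<tau> < k"
    "\<And>\<tau>. \<tau> \<in> missing_faces V X \<Longrightarrow> \<tau> \<notin> Y (i \<tau>)" by metis
  have "inj_on i (missing_faces V X)"
  proof (rule inj_onI)
    fix \<tau> \<tau>' assume \<tau>: "\<tau> \<in> missing_faces V X" "\<tau>' \<in> missing_faces V X" "i \<tau> = i \<tau>'"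
    have "X \<subseteq> Y (i \<tau>)" using Y(2) i(1)[OF \<tau>(1)] by blast
    then show "\<tau> = \<tau>'"
      using representable_superset_excludes_one_block[OF X S Y(1)[OF i(1)[OF \<tau>(1)]] _ \<tau>(1,2)]
        i(2) \<tau> by metis
  qed
  moreover have "i ` missing_faces V X \<subseteq> {..<k}" using i(1) by auto
  ultimately show "card (missing_faces V X) \<le> k"
    using card_inj_on_le[of i "missing_faces V X" "{..<k}"] by simp
qed

subsection \<open>Equality in the upper bound\<close>

text \<open>Placing each \<open>v \<in> Q\<close> at the diagonal point \<open>vec (g v)\<close>
  makes the nerve on \<open>Q\<close> a disjoint union of simplices, one for each label. All other
  vertices get a set \<open>H\<close> containing these points, so that no face of \<open>X\<close>
  is lost.\<close>

lemma cluster_complex: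
  fixes g :: "'v \<Rightarrow> real"
  assumes X: "abstract_complex V X" and Q: "finite Q"
    and g: "\<And>x y. x \<in> Q \<Longrightarrow> y \<in> Q \<Longrightarrow> {x, y} \<in> X \<longleftrightarrow> g x = g y"
  shows "\<exists>Y. representable_complex TYPE('d::finite) V Y \<and> X \<subseteq> Y \<and>
    (\<forall>\<kappa>\<in>Y. \<forall>x\<in>\<kappa> \<inter> Q. \<forall>y\<in>\<kappa> \<inter> Q. {x, y} \<in> X)"
proof -
  \<comment> \<open>The point \<open>vec 0\<close> keeps \<open>H\<close> nonempty when
    \<open>Q\<close> is empty.\<close>
  define H :: "(real ^ 'd) set" where "H = convex hull (insert (vec 0) (vec ` g ` Q))"
  define F where "F = (\<lambda>v. if v \<in> Q then {vec (g v)} else H)"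
  have H: "compact H" "convex H" "H \<noteq> {}" "\<And>x. x \<in> Q \<Longrightarrow> vec (g x) \<in> H"
    using Q by (auto simp: H_def finite_imp_compact_convex_hull intro: hull_inc)
  show ?thesis
  proof (intro exI[of _ "convex_nerve V F"] conjI ballI)
    show "representable_complex TYPE('d) V (convex_nerve V F)"
      using X H(1-3) by (intro representable_complexI) (auto simp: F_def abstract_complex_def)
    show "X \<subseteq> convex_nerve V F"
    proof
      fix \<rho> assume \<rho>: "\<rho> \<in> X"
      have "\<exists>p. \<forall>v\<in>\<rho>. p \<in> F v"
      proof (cases "\<rho> \<inter> Q = {}")
        case True
        then show ?thesis using H(3) by (auto simp: F_def)
      next
        case False
        then obtain x where x: "x \<in> \<rho>" "x \<in> Q" by blast
        have "vec (g x) \<in> F v" if v: "v \<in> \<rho>" for v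
        proof (cases "v \<in> Q")
          case True
          have "{x, v} \<subseteq> \<rho>" using x v by simp
          then have "{x, v} \<in> X" using X \<rho> unfolding abstract_complex_def by blast
          then show ?thesis using g[OF x(2) True] True by (simp add: F_def)
        qed (use H(4) x in \<open>simp add: F_def\<close>)
        then show ?thesis by blast
      qed
      then show "\<rho> \<in> convex_nerve V F"
        using X \<rho> by (auto simp: convex_nerve_def abstract_complex_def)
    qed
  next
    fix \<kappa> x y assume \<kappa>: "\<kappa> \<in> convex_nerve V F" and xy: "x \<in> \<kappa> \<inter> Q" "y \<in> \<kappa> \<inter> Q"
    then obtain p where "p \<in> F x" "p \<in> F y" by (auto simp: convex_nerve_def)
    then have "g x = g y" using xy by (auto simp: F_def vec_eq)
    then show "{x, y} \<in> X" using g[of x y] xy by simp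
  qed
qed

text \<open>Removing one or the other of two elements of \<open>\<rho>\<close> leaves
  \<open>d\<close>-sets lying in distinct members \<open>\<tau>0\<close>, \<open>\<tau>1\<close> of
  \<open>P\<close>. A single complex replaces the two belonging to them; it has to exclude both and
  also the missing faces that the remaining members do not reach.\<close>

lemma boxicity_less_card_packing:
  fixes P :: "'v set set"
  assumes X: "abstract_complex V X"
    and small: "\<And>\<kappa>. \<kappa> \<in> missing_faces V X \<Longrightarrow> card \<kappa> \<le> CARD('d::finite) + 1"
    and P: "\<And>\<tau>. \<tau> \<in> P \<Longrightarrow> \<tau> \<subseteq> V \<and> \<tau> \<notin> X \<and> card \<tau> = CARD('d) + 1" "packing CARD('d) P"
    and full: "\<And>\<eta>. \<eta> \<subseteq> V \<Longrightarrow> card \<eta> = CARD('d) \<Longrightarrow> \<exists>\<tau>\<in>P. \<eta> \<subseteq> \<tau>"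
    and \<rho>: "\<rho> \<subseteq> V" "\<rho> \<notin> X" "card \<rho> = CARD('d) + 1" "\<rho> \<notin> P"
  shows "boxicity TYPE('d) V X < enat (card P)"
proof -
  let ?d = "CARD('d)" and ?M = "missing_faces V X"
  have fin: "finite V" "finite P" "finite \<rho>"
    using X P(1) \<rho>(1) by (auto simp: abstract_complex_def finite_subset intro: finite_subset[of P "Pow V"])
  have Pfin: "finite \<tau>" if "\<tau> \<in> P" for \<tau> using P(1)[OF that] fin(1) finite_subset by blast
  have d1: "?d \<ge> 1" by (simp add: Suc_leI)
  have inP: "\<sigma> \<in> P" if "\<tau> \<in> P" "\<sigma> \<subseteq> \<tau>" "card \<sigma> = ?d + 1" for \<sigma> \<tau>
    using card_subset_eq[OF Pfin[OF that(1)] that(2)] that P(1)[OF that(1)] by simp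
  obtain r0 r1 where r: "r0 \<in> \<rho>" "r1 \<in> \<rho>" "r0 \<noteq> r1"
  proof -
    have "\<not> card \<rho> \<le> 1" using \<rho>(3) d1 by simp
    then show thesis using that card_le_Suc0_iff_eq[OF fin(3)] by auto
  qed
  obtain \<tau>0 where \<tau>0: "\<tau>0 \<in> P" "\<rho> - {r0} \<subseteq> \<tau>0"
    using full[of "\<rho> - {r0}"] \<rho> r by auto
  obtain \<tau>1 where \<tau>1: "\<tau>1 \<in> P" "\<rho> - {r1} \<subseteq> \<tau>1"
    using full[of "\<rho> - {r1}"] \<rho> r by auto
  have ne: "\<tau>0 \<noteq> \<tau>1"
  proof
    assume "\<tau>0 = \<tau>1"
    then have "\<rho> \<subseteq> \<tau>0" using \<tau>0 \<tau>1 r by auto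
    then show False using inP[OF \<tau>0(1)] \<rho> by blast
  qed
  define T where "T = P - {\<tau>0, \<tau>1}"
  have cardT: "card T + 1 < card P"
  proof -
    have "card {\<tau>0, \<tau>1} \<le> card P" using \<tau>0 \<tau>1 fin by (intro card_mono) auto
    then show ?thesis using \<tau>0 \<tau>1 ne fin by (simp add: T_def card_Diff_subset)
  qed
  \<comment> \<open>Extend \<open>\<kappa>\<close> to a \<open>(d + 1)\<close>-set
    \<open>\<kappa>'\<close> outside \<open>P\<close>. The members \<open>B x\<close> containing the
    sets \<open>\<kappa>' - {x}\<close> are pairwise different and cannot be in \<open>T\<close>, so
    there are at most two of them and \<open>d = 1\<close>.\<close>
  have uncovered: "?d = 1 \<and> (\<exists>x\<in>\<tau>0. \<exists>y\<in>\<tau>1. \<kappa> = {x, y})"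
    if \<kappa>: "\<kappa> \<in> ?M" "\<kappa> \<notin> P" and no: "\<not> (\<exists>\<tau>\<in>T. card (\<kappa> - \<tau>) \<le> 1)" for \<kappa>
  proof -
    have \<kappa>V: "\<kappa> \<subseteq> V" "\<kappa> \<notin> X" "card \<kappa> \<le> ?d + 1" "finite \<kappa>"
      using \<kappa> small fin(1) finite_subset by (auto simp: missing_faces_def)
    have "\<exists>\<kappa>'. \<kappa> \<subseteq> \<kappa>' \<and> \<kappa>' \<subseteq> V \<and> card \<kappa>' = ?d + 1 \<and> \<kappa>' \<notin> P"
    proof (cases "card \<kappa> = ?d + 1")
      case True
      then show ?thesis using \<kappa> \<kappa>V by blast
    next
      case False
      \<comment> \<open>Extend \<open>\<kappa>\<close> to a \<open>d\<close>-set
        \<open>\<eta>\<close> and add a vertex outside the member containing \<open>\<eta>\<close>;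
        the result is not in \<open>P\<close>, since only one member contains \<open>\<eta>\<close>.
        Such a vertex exists in \<open>\<rho>\<close>.\<close>
      have "card \<rho> \<le> card V" using \<rho>(1) fin(1) by (intro card_mono)
      then have "\<exists>\<eta>. \<kappa> \<subseteq> \<eta> \<and> \<eta> \<subseteq> V \<and> card \<eta> = ?d"
        using \<kappa>V False \<rho>(3) fin(1) by (intro exists_subset_between) auto
      then obtain \<eta> where \<eta>: "\<kappa> \<subseteq> \<eta>" "\<eta> \<subseteq> V" "card \<eta> = ?d" by blast
      obtain \<tau> where \<tau>: "\<tau> \<in> P" "\<eta> \<subseteq> \<tau>" using full[OF \<eta>(2,3)] by blast
      have "\<not> \<rho> \<subseteq> \<tau>" using inP[OF \<tau>(1)] \<rho> by blast
      then obtain v where v: "v \<in> V" "v \<notin> \<tau>" using \<rho>(1) by blast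
      have f: "finite \<eta>" using \<eta>(2) fin(1) finite_subset by blast
      have "insert v \<eta> \<notin> P"
      proof
        assume "insert v \<eta> \<in> P"
        then have "\<tau> = insert v \<eta>"
          using packing_eqI[OF P(2) \<tau>(1) _ Pfin[OF \<tau>(1)] \<tau>(2) _ \<eta>(3)] by blast
        then show False using v by blast
      qed
      moreover have "v \<notin> \<eta>" using v \<tau>(2) by blast
      then have "card (insert v \<eta>) = ?d + 1" using \<eta>(3) f by simp
      ultimately show ?thesis using \<eta> v by (intro exI[of _ "insert v \<eta>"]) auto
    qed
    then obtain \<kappa>' where \<kappa>': "\<kappa> \<subseteq> \<kappa>'" "\<kappa>' \<subseteq> V" "card \<kappa>' = ?d + 1" "\<kappa>' \<notin> P" by blast
    have f: "finite \<kappa>'" using \<kappa>'(2) fin(1) finite_subset by blast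
    have "\<forall>x\<in>\<kappa>'. \<exists>\<tau>\<in>P. \<kappa>' - {x} \<subseteq> \<tau>"
      using \<kappa>' f by (intro ballI full) auto
    then obtain B where B: "\<And>x. x \<in> \<kappa>' \<Longrightarrow> B x \<in> P" "\<And>x. x \<in> \<kappa>' \<Longrightarrow> \<kappa>' - {x} \<subseteq> B x"
      by metis
    have inj: "inj_on B \<kappa>'"
    proof (rule inj_onI, rule ccontr)
      fix x y assume xy: "x \<in> \<kappa>'" "y \<in> \<kappa>'" "B x = B y" "x \<noteq> y"
      then have "\<kappa>' \<subseteq> B x" using B(2)[of x] B(2)[of y] by auto
      then show False using inP[OF B(1)[OF xy(1)]] \<kappa>'(3,4) by blast
    qed
    have im: "B ` \<kappa>' \<subseteq> {\<tau>0, \<tau>1}"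
    proof (rule image_subsetI, rule ccontr)
      fix x assume x: "x \<in> \<kappa>'" "B x \<notin> {\<tau>0, \<tau>1}"
      have "\<kappa> - B x \<subseteq> {x}" using B(2)[OF x(1)] \<kappa>'(1) by auto
      then have "card (\<kappa> - B x) \<le> 1" using card_mono[of "{x}"] by force
      then show False using no B(1)[OF x(1)] x(2) by (auto simp: T_def)
    qed
    have "card \<kappa>' \<le> card {\<tau>0, \<tau>1}" using card_inj_on_le[OF inj im] by simp
    then have "?d \<le> 1" using \<kappa>'(3) ne by simp
    then have d: "?d = 1" using d1 by (rule antisym)
    then have "card \<kappa>' = 2" using \<kappa>'(3) by simp
    then obtain x y where xy: "\<kappa>' = {x, y}" "x \<noteq> y" unfolding card_2_iff by blast
    have "y \<in> B x" "x \<in> B y" using B(2)[of x] B(2)[of y] xy by auto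
    moreover have "B x \<noteq> B y" using inj xy by (auto simp: inj_on_def)
    ultimately have *: "(x \<in> \<tau>0 \<and> y \<in> \<tau>1) \<or> (y \<in> \<tau>0 \<and> x \<in> \<tau>1)" using im xy by auto
    have "{} \<in> X" "{x} \<in> X" "{y} \<in> X" using X \<kappa>'(2) xy by (auto simp: abstract_complex_def)
    moreover have "\<kappa> = {} \<or> \<kappa> = {x} \<or> \<kappa> = {y} \<or> \<kappa> = {x, y}" using \<kappa>'(1) xy(1) by blast
    ultimately have "\<kappa> = {x, y}" using \<kappa>V(2) by auto
    then show ?thesis using d * by blast
  qed
  have near: "card (\<tau>0 - \<rho>) \<le> 1" "card (\<tau>1 - \<rho>) \<le> 1"
  proof -
    have "?d \<le> card (\<tau>0 \<inter> \<rho>)"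
      using card_mono[of "\<tau>0 \<inter> \<rho>" "\<rho> - {r0}"] \<tau>0 \<rho>(3) r fin by auto
    then show "card (\<tau>0 - \<rho>) \<le> 1" using card_Diff_le_1I P(1)[OF \<tau>0(1)] by blast
    have "?d \<le> card (\<tau>1 \<inter> \<rho>)"
      using card_mono[of "\<tau>1 \<inter> \<rho>" "\<rho> - {r1}"] \<tau>1 \<rho>(3) r fin by auto
    then show "card (\<tau>1 - \<rho>) \<le> 1" using card_Diff_le_1I P(1)[OF \<tau>1(1)] by blast
  qed
  \<comment> \<open>The excluding complex of \<open>\<rho>\<close> serves, unless
    \<open>d = 1\<close> and elements \<open>e\<close>, \<open>a\<close> of \<open>\<tau>0\<close>,
    \<open>\<tau>1\<close> outside \<open>\<rho>\<close> form a non-face: that one has two elements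
    outside \<open>\<rho>\<close>.\<close>
  have "\<exists>Z. representable_complex TYPE('d) V Z \<and> X \<subseteq> Z \<and> \<tau>0 \<notin> Z \<and> \<tau>1 \<notin> Z \<and>
    (?d = 1 \<longrightarrow> (\<forall>x\<in>\<tau>0. \<forall>y\<in>\<tau>1. {x, y} \<in> ?M \<longrightarrow> {x, y} \<notin> Z))"
  proof (cases "?d = 1 \<and> (\<exists>e\<in>\<tau>0. \<exists>a\<in>\<tau>1. e \<notin> \<rho> \<and> a \<notin> \<rho> \<and> {e, a} \<notin> X)")
    case False
    obtain Z where Z: "representable_complex TYPE('d) V Z" "X \<subseteq> Z"
      "\<And>\<kappa>. \<kappa> \<subseteq> V \<Longrightarrow> \<kappa> \<notin> X \<Longrightarrow> card (\<kappa> - \<rho>) \<le> 1 \<Longrightarrow> \<kappa> \<notin> Z"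
      using excluding_complex[OF X \<rho>(1,2,3)] by metis
    have "{x, y} \<notin> Z" if "?d = 1" "x \<in> \<tau>0" "y \<in> \<tau>1" "{x, y} \<in> ?M" for x y
    proof -
      have xy: "{x, y} \<subseteq> V" "{x, y} \<notin> X" using that(4) by (auto simp: missing_faces_def)
      then have "x \<in> \<rho> \<or> y \<in> \<rho>" using False that by blast
      then have "{x, y} - \<rho> \<subseteq> {x} \<or> {x, y} - \<rho> \<subseteq> {y}" by blast
      then have "card ({x, y} - \<rho>) \<le> 1"
        using card_mono[of "{x}" "{x, y} - \<rho>"] card_mono[of "{y}" "{x, y} - \<rho>"] by auto
      then show ?thesis using Z(3) xy by blast
    qed
    then show ?thesis using Z near P(1) \<tau>0(1) \<tau>1(1) by blast
  next
    case True
    then obtain e a where ea: "?d = 1" "e \<in> \<tau>0" "a \<in> \<tau>1" "e \<notin> \<rho>" "a \<notin> \<rho>" "{e, a} \<notin> X"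
      by blast
    have \<rho>eq: "\<rho> = {r0, r1}"
      using card_seteq[of \<rho> "{r0, r1}"] fin(3) r \<rho>(3) ea(1) by simp
    have "r1 \<noteq> e" "r0 \<noteq> a" using ea r by auto
    then have c2: "card {r1, e} = ?d + 1" "card {r0, a} = ?d + 1" using ea(1) by simp_all
    have \<tau>0eq: "\<tau>0 = {r1, e}"
      using \<tau>0(2) ea r c2(1) P(1)[OF \<tau>0(1)]
      by (intro card_subset_eq[OF Pfin[OF \<tau>0(1)], symmetric]) auto
    have \<tau>1eq: "\<tau>1 = {r0, a}"
      using \<tau>1(2) ea r c2(2) P(1)[OF \<tau>1(1)]
      by (intro card_subset_eq[OF Pfin[OF \<tau>1(1)], symmetric]) auto
    have "card (\<tau>0 \<inter> \<tau>1) < 1"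
      using P(2) \<tau>0(1) \<tau>1(1) ne ea(1) by (auto simp: packing_def pairwise_def)
    then have disj: "\<tau>0 \<inter> \<tau>1 = {}" using Pfin[OF \<tau>0(1)] by simp
    have dist: "e \<noteq> a" "e \<noteq> r0" "e \<noteq> r1" "a \<noteq> r0" "a \<noteq> r1" "r0 \<noteq> r1"
      using ea r disj \<tau>0eq \<tau>1eq by auto
    have edges: "{r0, r1} \<notin> X" "{r1, e} \<notin> X" "{r0, a} \<notin> X" "{e, a} \<notin> X"
      using \<rho> P(1) \<tau>0(1) \<tau>1(1) ea(6) by (simp_all flip: \<rho>eq \<tau>0eq \<tau>1eq)
    have vert: "{e} \<in> X" "{a} \<in> X" "{r0} \<in> X" "{r1} \<in> X"
      using X \<rho>(1) r P(1)[OF \<tau>0(1)] P(1)[OF \<tau>1(1)] ea(2,3) by (auto simp: abstract_complex_def)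
    let ?Q = "{a, r0, r1, e}"
    \<comment> \<open>Within \<open>?Q\<close> only \<open>{a, r1}\<close> and
      \<open>{r0, e}\<close> can be edges. They are disjoint, so being equal or adjacent is an
      equivalence relation on \<open>?Q\<close>, and \<open>g\<close> labels its classes.\<close>
    define g :: "'v \<Rightarrow> real" where "g = (\<lambda>v. if v = a then 0
      else if v = r1 then (if {a, r1} \<in> X then 0 else 1)
      else if v = r0 then 2 else (if {r0, e} \<in> X then 2 else 3))"
    have g: "{x, y} \<in> X \<longleftrightarrow> g x = g y" if "x \<in> ?Q" "y \<in> ?Q" for x y
      using that dist edges vert
      by (elim insertE; simp add: g_def insert_commute)
    have "\<exists>Z. representable_complex TYPE('d) V Z \<and> X \<subseteq> Z \<and>
        (\<forall>\<kappa>\<in>Z. \<forall>x\<in>\<kappa> \<inter> ?Q. \<forall>y\<in>\<kappa> \<inter> ?Q. {x, y} \<in> X)"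
      by (rule cluster_complex[OF X]) (simp, rule g)
    then obtain Z where Z: "representable_complex TYPE('d) V Z" "X \<subseteq> Z"
      "\<forall>\<kappa>\<in>Z. \<forall>x\<in>\<kappa> \<inter> ?Q. \<forall>y\<in>\<kappa> \<inter> ?Q. {x, y} \<in> X"
      by (elim exE conjE) (rule that)
    have "\<tau>0 \<notin> Z" using Z(3) \<tau>0eq edges(2) by blast
    moreover have "\<tau>1 \<notin> Z" using Z(3) \<tau>1eq edges(3) by blast
    moreover have "{x, y} \<notin> Z" if "x \<in> \<tau>0" "y \<in> \<tau>1" "{x, y} \<in> ?M" for x y
    proof
      assume "{x, y} \<in> Z"
      have Q: "x \<in> ?Q" "y \<in> ?Q" using that \<tau>0eq \<tau>1eq by auto
      have "{x, y} \<in> X"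
        by (rule bspec[OF bspec[OF bspec[OF Z(3) \<open>{x, y} \<in> Z\<close>]]]) (use Q in simp_all)
      then show False using that(3) by (simp add: missing_faces_def)
    qed
    ultimately show ?thesis using Z(1,2) by blast
  qed
  then obtain Z where Z: "representable_complex TYPE('d) V Z" "X \<subseteq> Z" "\<tau>0 \<notin> Z" "\<tau>1 \<notin> Z"
    "?d = 1 \<Longrightarrow> \<forall>x\<in>\<tau>0. \<forall>y\<in>\<tau>1. {x, y} \<in> ?M \<longrightarrow> {x, y} \<notin> Z"
    by blast
  have "boxicity TYPE('d) V X \<le> enat (card T + card {Z})"
  proof (rule boxicity_le_cover[OF X])
    fix \<kappa> assume \<kappa>: "\<kappa> \<in> ?M"
    show "(\<exists>\<tau>\<in>T. card (\<kappa> - \<tau>) \<le> 1) \<or> (\<exists>Z\<in>{Z}. \<kappa> \<notin> Z)"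
    proof (cases "\<kappa> \<in> P")
      case True
      then show ?thesis using Z(3,4) by (cases "\<kappa> \<in> T") (force simp: T_def)+
    next
      case False
      then show ?thesis using uncovered[OF \<kappa>] Z(5) \<kappa> by blast
    qed
  qed (use fin P Z in \<open>auto simp: T_def\<close>)
  also have "\<dots> < enat (card P)" using cardT by simp
  finally show ?thesis .
qed

text \<open>A missing face with at most \<open>d\<close> elements would extend to a
  \<open>d\<close>-set \<open>\<eta>\<close>, and adding two different vertices to
  \<open>\<eta>\<close> would give two non-faces sharing it. So every missing face has
  \<open>d + 1\<close> elements, and a non-face of this size equals the missing face it
  contains.\<close>

lemma full_packing_is_missing_faces:
  assumes X: "abstract_complex V X"
    and small: "\<And>\<kappa>. \<kappa> \<in> missing_faces V X \<Longrightarrow> card \<kappa> \<le> d + 1"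
    and top: "\<tau> \<in> missing_faces V X" "card \<tau> = d + 1"
    and pack: "packing d {\<tau>. \<tau> \<subseteq> V \<and> \<tau> \<notin> X \<and> card \<tau> = d + 1}"
  shows "missing_faces V X = {\<tau>. \<tau> \<subseteq> V \<and> \<tau> \<notin> X \<and> card \<tau> = d + 1}" (is "?M = ?N")
proof -
  have fin: "finite V" and up: "\<And>\<sigma> \<rho>. \<sigma> \<notin> X \<Longrightarrow> \<sigma> \<subseteq> \<rho> \<Longrightarrow> \<rho> \<notin> X"
    using X by (auto simp: abstract_complex_def)
  have MN: "\<kappa> \<in> ?N" if \<kappa>: "\<kappa> \<in> ?M" for \<kappa>
  proof -
    have \<kappa>V: "\<kappa> \<subseteq> V" "\<kappa> \<notin> X" using \<kappa> by (auto simp: missing_faces_def)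
    have "card \<kappa> = d + 1"
    proof (rule ccontr)
      assume "card \<kappa> \<noteq> d + 1"
      then have le: "card \<kappa> \<le> d" using small[OF \<kappa>] by simp
      have \<tau>V: "\<tau> \<subseteq> V" using top by (auto simp: missing_faces_def)
      then have f\<tau>: "finite \<tau>" using fin finite_subset by blast
      \<comment> \<open>Two vertices outside \<open>\<eta>\<close> require
        \<open>d + 2 \<le> card V\<close>. One missing face does not lie inside another, so
        \<open>\<kappa>\<close> has a vertex beyond the \<open>d + 1\<close> vertices of
        \<open>\<tau>\<close>.\<close>
      have "\<not> \<kappa> \<subset> \<tau>" using top(1) \<kappa>V(2) unfolding missing_faces_def by blast
      moreover have "\<kappa> \<noteq> \<tau>" using le top(2) by auto
      ultimately obtain u where u: "u \<in> V" "u \<notin> \<tau>" using \<kappa>V(1) by blast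
      then have "card (insert u \<tau>) \<le> card V" using \<tau>V fin by (intro card_mono) auto
      then have cV: "d + 2 \<le> card V" using u(2) top(2) f\<tau> by simp
      obtain \<eta> where \<eta>: "\<kappa> \<subseteq> \<eta>" "\<eta> \<subseteq> V" "card \<eta> = d"
        using exists_subset_between[of \<kappa> d V] le cV \<kappa>V fin by auto
      have f\<eta>: "finite \<eta>" using \<eta>(2) fin finite_subset by blast
      have "\<not> card (V - \<eta>) \<le> 1" using cV \<eta> f\<eta> by (simp add: card_Diff_subset)
      then obtain v w where vw: "v \<in> V - \<eta>" "w \<in> V - \<eta>" "v \<noteq> w"
        using card_le_Suc0_iff_eq[of "V - \<eta>"] fin by auto
      have N: "insert x \<eta> \<in> ?N" if "x \<in> V - \<eta>" for x
        using that \<eta> f\<eta> up[OF \<kappa>V(2), of "insert x \<eta>"] by auto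
      have "insert v \<eta> = insert w \<eta>"
        using f\<eta> \<eta>(3) by (intro packing_eqI[OF pack N[OF vw(1)] N[OF vw(2)], of \<eta>]) auto
      then show False using vw by auto
    qed
    then show ?thesis using \<kappa>V by simp
  qed
  have "\<rho> \<in> ?M" if \<rho>: "\<rho> \<in> ?N" for \<rho>
  proof -
    have f: "finite \<rho>" using \<rho> fin finite_subset by auto
    then obtain \<kappa> where \<kappa>: "\<kappa> \<in> ?M" "\<kappa> \<subseteq> \<rho>" using missing_face_subset[OF f, of V X] \<rho> by auto
    then have "\<kappa> = \<rho>" using MN[OF \<kappa>(1)] \<rho> by (intro card_subset_eq[OF f]) auto
    then show ?thesis using \<kappa> by simp
  qed
  then show ?thesis using MN by blast
qed

section \<open>The bound and its equality case\<close>

theorem theorem1p2: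
  fixes V :: "'v set" and X :: "'v set set" and n d :: nat
  assumes "d = CARD('d::finite)"
    and "abstract_complex V X" and "card V = n"
    and "max_missing_dim V X \<le> int d"
  shows "(d < n \<or> X = Pow V \<longrightarrow>
            ereal_of_enat (boxicity TYPE('d) V X)
              \<le> ereal (real_of_int \<lfloor>1 / (real d + 1) * real (n choose d)\<rfloor>)) \<and>
         (max_missing_dim V X = int d \<longrightarrow>
            (ereal_of_enat (boxicity TYPE('d) V X) = ereal (1 / (real d + 1) * real (n choose d))
              \<longleftrightarrow> steiner_system d (d + 1) V (missing_faces V X)))"
proof -
  note d = assms(1) and X = assms(2) and n = assms(3)
  let ?box = "boxicity TYPE('d) V X" and ?M = "missing_faces V X"
  define N where "N = {\<tau>. \<tau> \<subseteq> V \<and> \<tau> \<notin> X \<and> card \<tau> = d + 1}"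
  have fin: "finite V" using X by (simp add: abstract_complex_def)
  have small: "card \<kappa> \<le> d + 1" if "\<kappa> \<in> ?M" for \<kappa>
    by (rule card_missing_face_le[OF fin assms(4) that])
  have "finite N" using fin by (simp add: N_def)
  moreover have "d \<le> card \<tau>" if "\<tau> \<in> N" for \<tau> using that by (simp add: N_def)
  ultimately obtain P where P: "P \<subseteq> N" "packing d P"
    and max: "\<And>\<rho>. \<rho> \<in> N \<Longrightarrow> \<exists>\<tau>\<in>P. d \<le> card (\<rho> \<inter> \<tau>)"
    using maximal_packing_exists[of N d] by metis
  have PN: "\<tau> \<subseteq> V \<and> \<tau> \<notin> X \<and> card \<tau> = d + 1" if "\<tau> \<in> P" for \<tau>
    using that P(1) by (auto simp: N_def)
  have finP: "finite P" using P(1) \<open>finite N\<close> finite_subset by blast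
  have cardP: "card P * (d + 1) \<le> n choose d"
    using card_packing(1)[OF fin _ P(2)] PN n by blast
  then have "real (card P) * (real d + 1) \<le> real (n choose d)"
    by (metis of_nat_1 of_nat_add of_nat_le_iff of_nat_mult)
  then have cardP_real: "real (card P) \<le> 1 / (real d + 1) * real (n choose d)"
    by (simp add: field_simps)
  have upper: "?box \<le> enat (card P)" if "d < n"
  proof -
    have "?box \<le> enat (card P + card ({} :: 'v set set set))"
    proof (rule boxicity_le_cover[OF X finP])
      fix \<kappa> assume \<kappa>: "\<kappa> \<in> ?M"
      then have \<kappa>V: "\<kappa> \<subseteq> V" "\<kappa> \<notin> X" by (auto simp: missing_faces_def)
      \<comment> \<open>A missing face extends to a non-face with \<open>d + 1\<close> elements; by
        maximality a member of \<open>P\<close> contains all but at most one of them.\<close>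
      have "d + 1 \<le> card V" using that n by simp
      then obtain \<rho> where \<rho>: "\<kappa> \<subseteq> \<rho>" "\<rho> \<subseteq> V" "card \<rho> = d + 1"
        using exists_subset_between[OF small[OF \<kappa>] _ \<kappa>V(1) fin] by blast
      then have "\<rho> \<in> N" using \<kappa>V X by (auto simp: N_def abstract_complex_def)
      then obtain \<tau> where \<tau>: "\<tau> \<in> P" "d \<le> card (\<rho> \<inter> \<tau>)" using max by blast
      have "card (\<kappa> - \<tau>) \<le> card (\<rho> - \<tau>)"
        using \<rho>(1) finite_subset[OF \<rho>(2) fin] by (intro card_mono) auto
      also have "\<dots> \<le> 1" using card_Diff_le_1I[OF \<rho>(3) \<tau>(2)] .
      finally show "(\<exists>\<tau>\<in>P. card (\<kappa> - \<tau>) \<le> 1) \<or> (\<exists>Z\<in>{}. \<kappa> \<notin> Z)" using \<tau>(1) by blast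
    qed (use PN d in auto)
    then show ?thesis by simp
  qed
  have bound: "ereal_of_enat ?box \<le> ereal (real_of_int \<lfloor>1 / (real d + 1) * real (n choose d)\<rfloor>)"
    if "d < n \<or> X = Pow V"
  proof -
    have "\<exists>k. ?box \<le> enat k \<and> real k \<le> 1 / (real d + 1) * real (n choose d)"
    proof (cases "d < n")
      case True
      then show ?thesis using upper cardP_real by blast
    next
      case False
      \<comment> \<open>The full simplex is the empty intersection, of boxicity 0.\<close>
      then have "X = Pow V \<inter> \<Inter>{}" using that by simp
      then have "?box \<le> enat (card ({} :: 'v set set set))" by (intro boxicity_le_card) auto
      then show ?thesis by (intro exI[of _ 0]) simp
    qed
    then obtain k where k: "?box \<le> enat k" "real k \<le> 1 / (real d + 1) * real (n choose d)"
      by blast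
    have "int k \<le> \<lfloor>1 / (real d + 1) * real (n choose d)\<rfloor>" using k(2) by (simp add: le_floor_iff)
    then have "real k \<le> real_of_int \<lfloor>1 / (real d + 1) * real (n choose d)\<rfloor>"
      by (metis of_int_le_iff of_int_of_nat_eq)
    moreover have "ereal_of_enat ?box \<le> ereal (real k)"
      using k(1) ereal_of_enat_le_iff[of ?box "enat k"] by simp
    ultimately show ?thesis by (meson ereal_less_eq(3) order_trans)
  qed
  have "ereal_of_enat ?box = ereal (1 / (real d + 1) * real (n choose d))
      \<longleftrightarrow> steiner_system d (d + 1) V ?M" if top: "max_missing_dim V X = int d"
  proof -
    obtain \<tau> where \<tau>: "\<tau> \<in> ?M" "card \<tau> = d + 1"
      by (rule missing_face_of_max_dim[OF fin top])
    have "\<tau> \<subseteq> V" using \<tau>(1) by (simp add: missing_faces_def)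
    then have "d < n" using card_mono[OF fin, of \<tau>] \<tau>(2) n by simp
    show ?thesis
    proof
      assume S: "steiner_system d (d + 1) V ?M"
      have "card ?M * (d + 1) = n choose d" using steiner_system_packing(2)[OF fin S] n by simp
      then have eq: "real (card ?M) * (real d + 1) = real (n choose d)"
        by (metis of_nat_1 of_nat_add of_nat_mult)
      have M: "1 / (real d + 1) * real (n choose d) = real (card ?M)"
        by (simp add: eq[symmetric])
      have "enat (card ?M) \<le> ?box"
        using boxicity_ge_steiner[OF X, where 'd='d] S d by simp
      then have "ereal (real (card ?M)) \<le> ereal_of_enat ?box"
        using ereal_of_enat_le_iff[of "enat (card ?M)" ?box] by simp
      moreover have "ereal_of_enat ?box \<le> ereal (real (card ?M))"
        using bound \<open>d < n\<close> unfolding M by simp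
      ultimately show "ereal_of_enat ?box = ereal (1 / (real d + 1) * real (n choose d))"
        unfolding M by (rule antisym[rotated])
    next
      assume box: "ereal_of_enat ?box = ereal (1 / (real d + 1) * real (n choose d))"
      have "ereal_of_enat ?box \<le> ereal (real (card P))"
        using upper[OF \<open>d < n\<close>] ereal_of_enat_le_iff[of ?box "enat (card P)"] by simp
      \<comment> \<open>The boxicity is at most \<open>card P\<close>, which is at most the bound;
        if the boxicity attains the bound, so does \<open>card P\<close>, and every
        \<open>d\<close>-set lies in a member of \<open>P\<close>.\<close>
      then have eq: "1 / (real d + 1) * real (n choose d) = real (card P)"
        unfolding box using cardP_real by simp
      then have "real (card P * (d + 1)) = real (n choose d)" by (simp add: field_simps)
      then have "card P * (d + 1) = card V choose d" using n by (simp only: of_nat_eq_iff)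
      then have full: "\<exists>\<tau>\<in>P. \<eta> \<subseteq> \<tau>" if "\<eta> \<subseteq> V" "card \<eta> = d" for \<eta>
        using card_packing(2)[OF fin _ P(2) _ that] PN by blast
      \<comment> \<open>A further non-face of size \<open>d + 1\<close> would push the boxicity
        below \<open>card P\<close>.\<close>
      have "N \<subseteq> P"
      proof (rule subsetI, rule ccontr)
        fix \<rho> assume \<rho>: "\<rho> \<in> N" "\<rho> \<notin> P"
        have "?box < enat (card P)"
        proof (rule boxicity_less_card_packing[OF X])
          show "card \<kappa> \<le> CARD('d) + 1" if "\<kappa> \<in> ?M" for \<kappa> using small[OF that] d by simp
          show "\<tau> \<subseteq> V \<and> \<tau> \<notin> X \<and> card \<tau> = CARD('d) + 1" if "\<tau> \<in> P" for \<tau>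
            using PN[OF that] d by simp
          show "packing CARD('d) P" using P(2) d by simp
          show "\<exists>\<tau>\<in>P. \<eta> \<subseteq> \<tau>" if "\<eta> \<subseteq> V" "card \<eta> = CARD('d)" for \<eta> using full that d by simp
        qed (use \<rho> d in \<open>auto simp: N_def\<close>)
        then show False
          using box eq ereal_of_enat_less_iff[of ?box "enat (card P)"] by simp
      qed
      then have "P = N" using P(1) by blast
      then have "?M = P"
        using full_packing_is_missing_faces[OF X small \<tau>] P(2) by (simp add: N_def)
      moreover have "B = C" if "B \<in> P" "C \<in> P" "\<eta> \<subseteq> B" "\<eta> \<subseteq> C" "card \<eta> = d" for B C \<eta>
      proof -
        have "finite B" using PN[OF that(1)] fin finite_subset by blast
        then show ?thesis by (rule packing_eqI[OF P(2) that(1,2) _ that(3-5)])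
      qed
      ultimately show "steiner_system d (d + 1) V ?M"
        unfolding steiner_system_def using full PN by (intro conjI ballI allI impI ex_ex1I) blast+
    qed
  qed
  then show ?thesis using bound by blast
qed

end
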